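(* Let $G_1,G_2,G_3,G_4$ denote the following families of finite $2$-groups (parameters are positive integers): (i) $G_1 = (\langle c \rangle\times \langle a\rangle)\rtimes \langle b\rangle$, where $[a,b]=c$, $[a,c]=[b,c]=1$, $o(a)=2^{\alpha}$, $o(b)=2^{\beta}$, $o(c)=2^{\gamma}$, with $\alpha\ge\beta\ge\gamma\ge 1$. (ii) $G_2 = \langle a \rangle\rtimes \langle b \rangle$, where $[a,b]=a^{2^{\alpha-\gamma}}$, $o(a)=2^{\alpha}$, $o(b)=2^{\beta}$, $o([a,b])=2^{\gamma}$, with $\alpha\ge 2\gamma$, $\beta\ge\gamma\ge 1$, $\alpha+\beta>3$. (iii) $G_3 = (\langle c \rangle\times \langle a\rangle)\rtimes \langle b\rangle$, where $[a,b]=a^{2^{\alpha-\gamma}}c$, $[c,b]=a^{-2^{2(\alpha-\gamma)}}c^{-2^{\alpha-\gamma}}$, $o(a)=2^{\alpha}$, $o(b)=2^{\beta}$, $o(c)=2^{\sigma}$, $o([a,b])=2^{\gamma}$, with $\beta\ge\gamma>\sigma\ge 1$, $\alpha+\sigma\ge 2\gamma$. (iv) $G_4 = (\langle c \rangle\times \langle a\rangle)\langle b\rangle$, where $o(a)=o(b)=2^{\gamma+1}$, $o([a,b])=2^{\gamma}$, $o(c)=2^{\gamma-1}$, $[a,b]=a^{2}c$, $[c,b]=a^{-4}c^{-2}$, $a^{2^{\gamma}}=b^{2^{\gamma}}$, with $\gamma\ge 1$. Then $\mathsf{D}_o(G)=\mathsf{L}(G)$ if any of the following holds: (1) $G\cong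 G_1$ with $\gamma=1$; (2) $G\cong G_2$; (3) $G\cong G_3$ with $\sigma=1$; (4) $G\cong G_4$ with $\gamma\in\{1,2\}$.
   Context: Commutators are $[x,y]=x^{-1}y^{-1}xy$, and $o(x)$ is the order of $x$. In $N\rtimes\langle b\rangle$ the subgroup $N$ is normal and $N\cap\langle b\rangle=1$, with the action of $b$ given by the listed commutators. $G_4$ is not a semidirect product: it is a non-split extension, equal to the product of the normal subgroup $\langle c\rangle\times\langle a\rangle$ with $\langle b\rangle$. An ordered sequence over a finite group $G$ is a finite tuple $S^*=(g_1,\dots,g_\ell)$ of elements of $G$ of length $|S^*|=\ell$; its nonempty ordered subsequences are $(g_{i_1},\dots,g_{i_k})$ with $k\ge1$ and $1\le i_1<\dots<i_k\le\ell$, with product $g_{i_1}\cdots g_{i_k}$ taken in the given order. $\Pi(S^* )$ is the set of products of all nonempty ordered subsequences. The ordered Davenport constant $\mathsf{D}_o(G)$ is the least $k\in\mathbb{N}$ such that every ordered sequence $S^*$ over $G$ with $|S^*|\ge k$ satisfies $1\in\Pi(S^* )$. For a prime $p$ and a finite $p$-group $G$, the Loewy length $\mathsf{L}(G)$ is the nilpotency index of the Jacobson radical $J$ of the group algebra $\mathbb{F}_p[G]$, i.e. the least $n\ge 1$ with $J^n=0$ (here $p=2$). *)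

theory Defs
  imports
    "HOL-Algebra.Algebra"
    "HOL-Number_Theory.Residues"
    "HOL-Library.Sublist"
begin

section \<open>The ordered Davenport constant\<close>

definition list_prod :: "('a, 'm) monoid_scheme \<Rightarrow> 'a list \<Rightarrow> 'a" where
  "list_prod G S = foldr (\<lambda>x y. x \<otimes>\<^bsub>G\<^esub> y) S \<one>\<^bsub>G\<^esub>"

definition ordered_products :: "('a, 'm) monoid_scheme \<Rightarrow> 'a list \<Rightarrow> 'a set" where
  "ordered_products G S = {list_prod G T | T. T \<noteq> [] \<and> subseq T S}"

definition ordered_davenport :: "('a, 'm) monoid_scheme \<Rightarrow> nat" where
  "ordered_davenport G =
     (LEAST k. \<forall>S. set S \<subseteq> carrier G \<and> length S \<ge> k \<longrightarrow> \<one>\<^bsub>G\<^esub> \<in> ordered_products G S)"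


section \<open>Group algebras and the Loewy length\<close>

text \<open>
  The group algebra is only meant for finite groups: its elements are all functions from the
  group to the coefficient ring (made extensional), multiplied by convolution.
\<close>

definition group_algebra ::
    "('r, 'n) ring_scheme \<Rightarrow> ('a, 'm) monoid_scheme \<Rightarrow> ('a \<Rightarrow> 'r) ring" where
  "group_algebra R G =
    \<lparr>carrier = carrier G \<rightarrow>\<^sub>E carrier R,
     monoid.mult = (\<lambda>f g. \<lambda>x\<in>carrier G.
               \<Oplus>\<^bsub>R\<^esub>y\<in>carrier G. f y \<otimes>\<^bsub>R\<^esub> g (inv\<^bsub>G\<^esub> y \<otimes>\<^bsub>G\<^esub> x)),
     one = (\<lambda>x\<in>carrier G. if x = \<one>\<^bsub>G\<^esub> then \<one>\<^bsub>R\<^esub> else \<zero>\<^bsub>R\<^esub>),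
     ring.zero = (\<lambda>x\<in>carrier G. \<zero>\<^bsub>R\<^esub>),
     ring.add = (\<lambda>f g. \<lambda>x\<in>carrier G. f x \<oplus>\<^bsub>R\<^esub> g x)\<rparr>"

definition left_ideal :: "'a set \<Rightarrow> ('a, 'm) ring_scheme \<Rightarrow> bool" where
  "left_ideal I R \<longleftrightarrow>
     additive_subgroup I R \<and> (\<forall>x\<in>carrier R. \<forall>a\<in>I. x \<otimes>\<^bsub>R\<^esub> a \<in> I)"

definition maximal_left_ideal :: "'a set \<Rightarrow> ('a, 'm) ring_scheme \<Rightarrow> bool" where
  "maximal_left_ideal I R \<longleftrightarrow>
     left_ideal I R \<and> I \<noteq> carrier R \<and>
     (\<forall>K. left_ideal K R \<and> I \<subseteq> K \<longrightarrow> K = I \<or> K = carrier R)"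

definition jacobson_radical :: "('a, 'm) ring_scheme \<Rightarrow> 'a set" where
  "jacobson_radical R = carrier R \<inter> \<Inter>{I. maximal_left_ideal I R}"

primrec ideal_power :: "('a, 'm) ring_scheme \<Rightarrow> 'a set \<Rightarrow> nat \<Rightarrow> 'a set" where
  "ideal_power R I 0 = carrier R"
| "ideal_power R I (Suc n) = ideal_prod R (ideal_power R I n) I"

definition loewy_length :: "nat \<Rightarrow> ('a, 'm) monoid_scheme \<Rightarrow> nat" where
  "loewy_length p G =
     (let A = group_algebra (residue_ring (int p)) G
      in LEAST n. n \<ge> 1 \<and> ideal_power A (jacobson_radical A) n = {\<zero>\<^bsub>A\<^esub>})"


section \<open>The four families of groups\<close>

definition group_commutator :: "('a, 'm) monoid_scheme \<Rightarrow> 'a \<Rightarrow> 'a \<Rightarrow> 'a" where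
  "group_commutator G x y = inv\<^bsub>G\<^esub> x \<otimes>\<^bsub>G\<^esub> inv\<^bsub>G\<^esub> y \<otimes>\<^bsub>G\<^esub> x \<otimes>\<^bsub>G\<^esub> y"

abbreviation cyclic_sub :: "('a, 'm) monoid_scheme \<Rightarrow> 'a \<Rightarrow> 'a set" where
  "cyclic_sub G x \<equiv> generate G {x}"

text \<open>The product of \<open>H\<close> and \<open>K\<close> is direct; the product itself is the set \<open>H <#> K\<close>.\<close>

definition internal_direct :: "('a, 'm) monoid_scheme \<Rightarrow> 'a set \<Rightarrow> 'a set \<Rightarrow> bool" where
  "internal_direct G H K \<longleftrightarrow>
     subgroup H G \<and> subgroup K G \<and> H \<inter> K = {\<one>\<^bsub>G\<^esub>} \<and>
     (\<forall>h\<in>H. \<forall>k\<in>K. h \<otimes>\<^bsub>G\<^esub> k = k \<otimes>\<^bsub>G\<^esub> h)"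

definition internal_semidirect :: "('a, 'm) monoid_scheme \<Rightarrow> 'a set \<Rightarrow> 'a set \<Rightarrow> bool" where
  "internal_semidirect G N H \<longleftrightarrow>
     N \<lhd> G \<and> subgroup H G \<and> N \<inter> H = {\<one>\<^bsub>G\<^esub>} \<and> N <#>\<^bsub>G\<^esub> H = carrier G"

text \<open>
  \<open>is_G1 G \<alpha> \<beta> \<gamma>\<close> says that \<open>G\<close> is (isomorphic to) the member of the first
  family with these parameters, i.e. that it contains generators \<open>a\<close>, \<open>b\<close>, \<open>c\<close> as prescribed; the
  other families are treated in the same way. Finiteness of \<open>G\<close> follows, since the orders of the
  generators are powers of two and \<^const>\<open>group.ord\<close> is \<open>0\<close> for elements of infinite order.
  All subtractions in exponents are exact under the stated bounds on the parameters.
\<close>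

definition is_G1 :: "('a, 'm) monoid_scheme \<Rightarrow> nat \<Rightarrow> nat \<Rightarrow> nat \<Rightarrow> bool" where
  "is_G1 G \<alpha> \<beta> \<gamma> \<longleftrightarrow>
     group G \<and> \<alpha> \<ge> \<beta> \<and> \<beta> \<ge> \<gamma> \<and> \<gamma> \<ge> 1 \<and>
     (\<exists>a\<in>carrier G. \<exists>b\<in>carrier G. \<exists>c\<in>carrier G.
        internal_direct G (cyclic_sub G c) (cyclic_sub G a) \<and>
        internal_semidirect G (cyclic_sub G c <#>\<^bsub>G\<^esub> cyclic_sub G a) (cyclic_sub G b) \<and>
        group_commutator G a b = c \<and>
        group_commutator G a c = \<one>\<^bsub>G\<^esub> \<and>
        group_commutator G b c = \<one>\<^bsub>G\<^esub> \<and>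
        group.ord G a = 2 ^ \<alpha> \<and> group.ord G b = 2 ^ \<beta> \<and> group.ord G c = 2 ^ \<gamma>)"

definition is_G2 :: "('a, 'm) monoid_scheme \<Rightarrow> nat \<Rightarrow> nat \<Rightarrow> nat \<Rightarrow> bool" where
  "is_G2 G \<alpha> \<beta> \<gamma> \<longleftrightarrow>
     group G \<and> \<alpha> \<ge> 2 * \<gamma> \<and> \<beta> \<ge> \<gamma> \<and> \<gamma> \<ge> 1 \<and> \<alpha> + \<beta> > 3 \<and>
     (\<exists>a\<in>carrier G. \<exists>b\<in>carrier G.
        internal_semidirect G (cyclic_sub G a) (cyclic_sub G b) \<and>
        group_commutator G a b = a [^]\<^bsub>G\<^esub> ((2::nat) ^ (\<alpha> - \<gamma>)) \<and>
        group.ord G a = 2 ^ \<alpha> \<and> group.ord G b = 2 ^ \<beta> \<and>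
        group.ord G (group_commutator G a b) = 2 ^ \<gamma>)"

definition is_G3 :: "('a, 'm) monoid_scheme \<Rightarrow> nat \<Rightarrow> nat \<Rightarrow> nat \<Rightarrow> nat \<Rightarrow> bool" where
  "is_G3 G \<alpha> \<beta> \<gamma> \<sigma> \<longleftrightarrow>
     group G \<and> \<beta> \<ge> \<gamma> \<and> \<gamma> > \<sigma> \<and> \<sigma> \<ge> 1 \<and> \<alpha> + \<sigma> \<ge> 2 * \<gamma> \<and>
     (\<exists>a\<in>carrier G. \<exists>b\<in>carrier G. \<exists>c\<in>carrier G.
        internal_direct G (cyclic_sub G c) (cyclic_sub G a) \<and>
        internal_semidirect G (cyclic_sub G c <#>\<^bsub>G\<^esub> cyclic_sub G a) (cyclic_sub G b) \<and>
        group_commutator G a b = a [^]\<^bsub>G\<^esub> ((2::nat) ^ (\<alpha> - \<gamma>)) \<otimes>\<^bsub>G\<^esub> c \<and>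
        group_commutator G c b =
          a [^]\<^bsub>G\<^esub> (- ((2::int) ^ (2 * (\<alpha> - \<gamma>)))) \<otimes>\<^bsub>G\<^esub> c [^]\<^bsub>G\<^esub> (- ((2::int) ^ (\<alpha> - \<gamma>))) \<and>
        group.ord G a = 2 ^ \<alpha> \<and> group.ord G b = 2 ^ \<beta> \<and> group.ord G c = 2 ^ \<sigma> \<and>
        group.ord G (group_commutator G a b) = 2 ^ \<gamma>)"

text \<open>
  Here the product of \<open>\<langle>c\<rangle> \<times> \<langle>a\<rangle>\<close> with \<open>\<langle>b\<rangle>\<close> is not semidirect, because
  \<open>a ^ 2 ^ \<gamma> = b ^ 2 ^ \<gamma>\<close>. The intersection need not be prescribed: the relations make
  \<open>[a, b]\<close> central of order \<open>2 ^ \<gamma>\<close>, so no smaller power \<open>b ^ 2 ^ i\<close> (\<open>i < \<gamma>\<close>) commutes with \<open>a\<close>,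
  and the intersection is generated by \<open>b ^ 2 ^ \<gamma>\<close>.
\<close>

definition is_G4 :: "('a, 'm) monoid_scheme \<Rightarrow> nat \<Rightarrow> bool" where
  "is_G4 G \<gamma> \<longleftrightarrow>
     group G \<and> \<gamma> \<ge> 1 \<and>
     (\<exists>a\<in>carrier G. \<exists>b\<in>carrier G. \<exists>c\<in>carrier G.
        internal_direct G (cyclic_sub G c) (cyclic_sub G a) \<and>
        (cyclic_sub G c <#>\<^bsub>G\<^esub> cyclic_sub G a) \<lhd> G \<and>
        (cyclic_sub G c <#>\<^bsub>G\<^esub> cyclic_sub G a) <#>\<^bsub>G\<^esub> cyclic_sub G b = carrier G \<and>
        group.ord G a = 2 ^ (\<gamma> + 1) \<and> group.ord G b = 2 ^ (\<gamma> + 1) \<and>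
        group.ord G (group_commutator G a b) = 2 ^ \<gamma> \<and> group.ord G c = 2 ^ (\<gamma> - 1) \<and>
        group_commutator G a b = a [^]\<^bsub>G\<^esub> (2::nat) \<otimes>\<^bsub>G\<^esub> c \<and>
        group_commutator G c b = a [^]\<^bsub>G\<^esub> (-4::int) \<otimes>\<^bsub>G\<^esub> c [^]\<^bsub>G\<^esub> (-2::int) \<and>
        a [^]\<^bsub>G\<^esub> ((2::nat) ^ \<gamma>) = b [^]\<^bsub>G\<^esub> ((2::nat) ^ \<gamma>))"

end

theory Submission
  imports Defs
begin

text \<open>
For all groups of the theorem, both constants equal an explicit number \<open>N\<close>. This follows from a
cycle of three inequalities, of which the first is not specific to these groups.

\<^item> \<^emph>\<open>The Davenport constant is at most the Loewy length,\<close> if the augmentation ideal is nilpotent. If no ordered subsequence of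
\<open>(g\<^sub>1, \<dots>, g\<^sub>l)\<close> has product one, then the coefficient of the identity in
\<open>(1 + g\<^sub>1) \<dots> (1 + g\<^sub>l)\<close> is one, so the product is nonzero. It lies in the \<open>l\<close>-th power of
the augmentation ideal, which is the Jacobson radical as soon as it is nilpotent
(\<open>jacobson_radical_eq_augmentation\<close>, \<open>product_one_if_vanishing_power\<close>).

\<^item> \<^emph>\<open>The Loewy length is at most \<open>N\<close>.\<close> The four families share one shape: \<open>G\<close> is the product of an
abelian normal subgroup \<open>\<langle>c\<rangle> \<times> \<langle>a\<rangle>\<close> and \<open>\<langle>b\<rangle>\<close>, where \<open>o(a) = 2\<^sup>\<alpha>\<close>, \<open>o(c) = 2\<^sup>\<kappa> \<le> 2\<close>, \<open>b\<close> has order \<open>2\<^sup>\<beta>\<close>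
modulo that subgroup, \<open>[a, b]\<close> is \<open>c\<close> times an even power of \<open>a\<close>, and \<open>[c, b]\<close> is a power of \<open>a\<^sup>4\<close>.
Put \<open>\<xi> = a + 1\<close>, \<open>\<eta> = b + 1\<close>, \<open>\<zeta> = c + 1\<close>, give them the weights 1, 1, 2 (as
in Jennings' description of the radical series) and let \<open>F d\<close> be the span of the monomials
\<open>\<eta>\<^sup>j \<xi>\<^sup>i \<zeta>\<^sup>k\<close> of weight \<open>j + i + 2 k \<ge> d\<close>. The shape of the commutators makes
right multiplication by \<open>g + 1\<close> send \<open>F d\<close> into \<open>F (d + 1)\<close> for every \<open>g\<close>, so the \<open>d\<close>-th power of
the augmentation ideal lies in \<open>F d\<close>. As \<open>\<xi>\<close>, \<open>\<zeta>\<close> have nilpotency exponents \<open>2\<^sup>\<alpha>\<close>, \<open>2\<^sup>\<kappa>\<close>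
and \<open>\<eta>\<close> to the power \<open>2\<^sup>\<beta>\<close> is either zero or the same power of \<open>\<xi>\<close>, all monomials of weight at least
\<open>N = (2\<^sup>\<alpha> - 1) + (2\<^sup>\<beta> - 1) + 2 (2\<^sup>\<kappa> - 1) + 1\<close> vanish (\<open>F_top\<close>).

\<^item> \<^emph>\<open>The Davenport constant is at least \<open>N\<close>.\<close> The sequence consisting of \<open>2\<^sup>\<alpha> - 1\<close> copies of \<open>a\<close>, then
\<open>2\<^sup>\<beta> - 1\<close> copies of \<open>b\<close> and, if \<open>c \<noteq> 1\<close>, the two further terms \<open>a c\<close> and \<open>b c\<close>, has length \<open>N - 1\<close>
and no subsequence with product one (\<open>free_seq_free\<close>).
\<close>


section \<open>Group algebras of finite groups\<close>

lemma (in abelian_monoid) finsum_swap: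
  assumes "finite A" "finite B"
    and "\<And>x y. x \<in> A \<Longrightarrow> y \<in> B \<Longrightarrow> f x y \<in> carrier G"
  shows "(\<Oplus>x\<in>A. \<Oplus>y\<in>B. f x y) = (\<Oplus>y\<in>B. \<Oplus>x\<in>A. f x y)"
  using assms(1,3)
proof (induction A rule: finite_induct)
  case empty
  then show ?case by simp
next
  case (insert a A)
  have "(\<Oplus>y\<in>B. \<Oplus>x\<in>insert a A. f x y) = (\<Oplus>y\<in>B. f a y \<oplus> (\<Oplus>x\<in>A. f x y))"
    using insert by (intro finsum_cong') (auto intro!: finsum_closed)
  also have "\<dots> = (\<Oplus>y\<in>B. f a y) \<oplus> (\<Oplus>y\<in>B. \<Oplus>x\<in>A. f x y)"
    using insert by (intro finsum_addf) (auto intro!: finsum_closed)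
  finally show ?case
    using insert by (simp add: Pi_def finsum_closed)
qed

locale finite_group_algebra = R: ring R + G: group G
  for R :: "('r, 'n) ring_scheme" and G :: "('a, 'm) monoid_scheme" +
  assumes fin: "finite (carrier G)"
begin

abbreviation "A \<equiv> group_algebra R G"

definition of_group :: "'a \<Rightarrow> 'a \<Rightarrow> 'r" where
  "of_group g = (\<lambda>x\<in>carrier G. if x = g then \<one>\<^bsub>R\<^esub> else \<zero>\<^bsub>R\<^esub>)"

lemma carrier_A: "carrier A = carrier G \<rightarrow>\<^sub>E carrier R"
  and zero_A: "\<zero>\<^bsub>A\<^esub> = (\<lambda>x\<in>carrier G. \<zero>\<^bsub>R\<^esub>)"
  and one_A: "\<one>\<^bsub>A\<^esub> = of_group \<one>\<^bsub>G\<^esub>"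
  and mult_A: "f \<otimes>\<^bsub>A\<^esub> h = (\<lambda>x\<in>carrier G.
                 \<Oplus>\<^bsub>R\<^esub>y\<in>carrier G. f y \<otimes>\<^bsub>R\<^esub> h (inv\<^bsub>G\<^esub> y \<otimes>\<^bsub>G\<^esub> x))"
  and add_A: "f \<oplus>\<^bsub>A\<^esub> h = (\<lambda>x\<in>carrier G. f x \<oplus>\<^bsub>R\<^esub> h x)"
  by (simp_all add: group_algebra_def of_group_def)

lemma A_apply: "f \<in> carrier A \<Longrightarrow> x \<in> carrier G \<Longrightarrow> f x \<in> carrier R"
  by (auto simp: carrier_A)

lemma A_eqI:
  "f \<in> carrier A \<Longrightarrow> h \<in> carrier A \<Longrightarrow> (\<And>x. x \<in> carrier G \<Longrightarrow> f x = h x) \<Longrightarrow> f = h"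
  by (auto simp: carrier_A intro: PiE_ext)

lemma of_group_closed: "of_group g \<in> carrier A"
  by (auto simp: of_group_def carrier_A)

lemma add_A_closed: "f \<in> carrier A \<Longrightarrow> h \<in> carrier A \<Longrightarrow> f \<oplus>\<^bsub>A\<^esub> h \<in> carrier A"
  by (auto simp: carrier_A add_A)

lemma mult_A_closed: "f \<in> carrier A \<Longrightarrow> h \<in> carrier A \<Longrightarrow> f \<otimes>\<^bsub>A\<^esub> h \<in> carrier A"
  by (auto simp: carrier_A mult_A Pi_def intro!: R.finsum_closed)

text \<open>
Only \<open>y = x g\<^sup>-\<^sup>1\<close> contributes to the convolution sum. Right multiplication by a group element is
thus a permutation of coefficients, which is how coefficients of products are read off later.
\<close>

lemma mult_of_group:
  assumes f: "f \<in> carrier A" and g: "g \<in> carrier G" and x: "x \<in> carrier G"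
  shows "(f \<otimes>\<^bsub>A\<^esub> of_group g) x = f (x \<otimes>\<^bsub>G\<^esub> inv\<^bsub>G\<^esub> g)"
proof -
  have eq: "inv\<^bsub>G\<^esub> y \<otimes>\<^bsub>G\<^esub> x = g \<longleftrightarrow> y = x \<otimes>\<^bsub>G\<^esub> inv\<^bsub>G\<^esub> g" if "y \<in> carrier G" for y
    using that g x by (metis G.inv_closed G.inv_inv G.inv_solve_left G.inv_solve_right)
  have "(f \<otimes>\<^bsub>A\<^esub> of_group g) x =
      (\<Oplus>\<^bsub>R\<^esub>y\<in>carrier G. if y = x \<otimes>\<^bsub>G\<^esub> inv\<^bsub>G\<^esub> g then f y else \<zero>\<^bsub>R\<^esub>)"
    using f g x by (auto simp: mult_A of_group_def eq A_apply intro!: R.finsum_cong')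
  also have "\<dots> = f (x \<otimes>\<^bsub>G\<^esub> inv\<^bsub>G\<^esub> g)"
    using f g x fin by (intro R.add.finprod_singleton_swap) (auto simp: A_apply)
  finally show ?thesis .
qed

lemma of_group_mult:
  assumes "g \<in> carrier G" "h \<in> carrier G"
  shows "of_group g \<otimes>\<^bsub>A\<^esub> of_group h = of_group (g \<otimes>\<^bsub>G\<^esub> h)"
proof (rule A_eqI)
  fix x assume x: "x \<in> carrier G"
  have "x \<otimes>\<^bsub>G\<^esub> inv\<^bsub>G\<^esub> h = g \<longleftrightarrow> x = g \<otimes>\<^bsub>G\<^esub> h"
    using x assms by (metis G.inv_solve_right')
  then show "(of_group g \<otimes>\<^bsub>A\<^esub> of_group h) x = of_group (g \<otimes>\<^bsub>G\<^esub> h) x"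
    using assms x by (simp add: mult_of_group[OF of_group_closed]) (simp add: of_group_def)
qed (auto intro: of_group_closed mult_A_closed)

text \<open>
Both sides are double sums over the group; they agree after interchanging the summations and
substituting \<open>y = z w\<close> for the intermediate point of the convolution.
\<close>

lemma mult_A_assoc:
  assumes f: "f \<in> carrier A" and g: "g \<in> carrier A" and h: "h \<in> carrier A"
  shows "(f \<otimes>\<^bsub>A\<^esub> g) \<otimes>\<^bsub>A\<^esub> h = f \<otimes>\<^bsub>A\<^esub> (g \<otimes>\<^bsub>A\<^esub> h)"
proof (rule A_eqI)
  fix x assume x: "x \<in> carrier G"
  let ?C = "carrier G"
  note [simp] = A_apply[OF f] A_apply[OF g] A_apply[OF h]
  have "((f \<otimes>\<^bsub>A\<^esub> g) \<otimes>\<^bsub>A\<^esub> h) x =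
      (\<Oplus>\<^bsub>R\<^esub>y\<in>?C. \<Oplus>\<^bsub>R\<^esub>z\<in>?C. f z \<otimes>\<^bsub>R\<^esub> g (inv\<^bsub>G\<^esub> z \<otimes>\<^bsub>G\<^esub> y) \<otimes>\<^bsub>R\<^esub> h (inv\<^bsub>G\<^esub> y \<otimes>\<^bsub>G\<^esub> x))"
    using x fin by (auto simp: mult_A R.finsum_ldistr Pi_def intro!: R.finsum_cong' R.finsum_closed)
  also have "\<dots> =
      (\<Oplus>\<^bsub>R\<^esub>z\<in>?C. \<Oplus>\<^bsub>R\<^esub>y\<in>?C. f z \<otimes>\<^bsub>R\<^esub> g (inv\<^bsub>G\<^esub> z \<otimes>\<^bsub>G\<^esub> y) \<otimes>\<^bsub>R\<^esub> h (inv\<^bsub>G\<^esub> y \<otimes>\<^bsub>G\<^esub> x))"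
    using x fin by (intro R.finsum_swap) auto
  also have "\<dots> =
      (\<Oplus>\<^bsub>R\<^esub>z\<in>?C. \<Oplus>\<^bsub>R\<^esub>w\<in>?C. f z \<otimes>\<^bsub>R\<^esub> g w \<otimes>\<^bsub>R\<^esub> h (inv\<^bsub>G\<^esub> w \<otimes>\<^bsub>G\<^esub> (inv\<^bsub>G\<^esub> z \<otimes>\<^bsub>G\<^esub> x)))"
  proof (rule R.finsum_cong'[OF refl])
    show "(\<lambda>z. \<Oplus>\<^bsub>R\<^esub>w\<in>?C. f z \<otimes>\<^bsub>R\<^esub> g w \<otimes>\<^bsub>R\<^esub> h (inv\<^bsub>G\<^esub> w \<otimes>\<^bsub>G\<^esub> (inv\<^bsub>G\<^esub> z \<otimes>\<^bsub>G\<^esub> x))) \<in> ?C \<rightarrow> carrier R"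
      using x by (intro funcsetI R.finsum_closed) auto
    fix z assume z: "z \<in> ?C"
    let ?F = "\<lambda>y. f z \<otimes>\<^bsub>R\<^esub> g (inv\<^bsub>G\<^esub> z \<otimes>\<^bsub>G\<^esub> y) \<otimes>\<^bsub>R\<^esub> h (inv\<^bsub>G\<^esub> y \<otimes>\<^bsub>G\<^esub> x)"
    have "(\<Oplus>\<^bsub>R\<^esub>y\<in>?C. ?F y) = (\<Oplus>\<^bsub>R\<^esub>y\<in>(\<lambda>w. z \<otimes>\<^bsub>G\<^esub> w) ` ?C. ?F y)"
      using z by (simp add: G.surj_const_mult)
    also have "\<dots> = (\<Oplus>\<^bsub>R\<^esub>w\<in>?C. ?F (z \<otimes>\<^bsub>G\<^esub> w))"
      using z x by (intro R.finsum_reindex) (auto simp: G.inj_on_cmult)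
    also have "\<dots> = (\<Oplus>\<^bsub>R\<^esub>w\<in>?C. f z \<otimes>\<^bsub>R\<^esub> g w \<otimes>\<^bsub>R\<^esub> h (inv\<^bsub>G\<^esub> w \<otimes>\<^bsub>G\<^esub> (inv\<^bsub>G\<^esub> z \<otimes>\<^bsub>G\<^esub> x)))"
      using z x by (intro R.finsum_cong')
        (auto simp: G.inv_mult_group G.m_assoc[symmetric])
    finally show "(\<Oplus>\<^bsub>R\<^esub>y\<in>?C. ?F y) =
      (\<Oplus>\<^bsub>R\<^esub>w\<in>?C. f z \<otimes>\<^bsub>R\<^esub> g w \<otimes>\<^bsub>R\<^esub> h (inv\<^bsub>G\<^esub> w \<otimes>\<^bsub>G\<^esub> (inv\<^bsub>G\<^esub> z \<otimes>\<^bsub>G\<^esub> x)))" .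
  qed
  also have "\<dots> = (f \<otimes>\<^bsub>A\<^esub> (g \<otimes>\<^bsub>A\<^esub> h)) x"
    using x fin
    by (auto simp: mult_A R.finsum_rdistr R.m_assoc Pi_def intro!: R.finsum_cong' R.finsum_closed)
  finally show "((f \<otimes>\<^bsub>A\<^esub> g) \<otimes>\<^bsub>A\<^esub> h) x = (f \<otimes>\<^bsub>A\<^esub> (g \<otimes>\<^bsub>A\<^esub> h)) x" .
qed (auto intro: mult_A_closed f g h)

lemma abelian_group_A: "abelian_group A"
proof (rule abelian_groupI)
  fix f assume f: "f \<in> carrier A"
  show "\<exists>h\<in>carrier A. h \<oplus>\<^bsub>A\<^esub> f = \<zero>\<^bsub>A\<^esub>"
    using A_apply[OF f] by (intro bexI[of _ "\<lambda>x\<in>carrier G. \<ominus>\<^bsub>R\<^esub> f x"])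
      (auto simp: add_A zero_A carrier_A R.l_neg)
next
  fix f g h assume fgh: "f \<in> carrier A" "g \<in> carrier A" "h \<in> carrier A"
  note [simp] = fgh[THEN A_apply]
  show "f \<oplus>\<^bsub>A\<^esub> g \<oplus>\<^bsub>A\<^esub> h = f \<oplus>\<^bsub>A\<^esub> (g \<oplus>\<^bsub>A\<^esub> h)"
    by (rule A_eqI; (intro add_A_closed fgh)?) (simp add: add_A R.a_assoc)
next
  fix f g assume fg: "f \<in> carrier A" "g \<in> carrier A"
  note [simp] = fg[THEN A_apply]
  show "f \<oplus>\<^bsub>A\<^esub> g = g \<oplus>\<^bsub>A\<^esub> f"
    by (rule A_eqI; (intro add_A_closed fg)?) (simp add: add_A R.a_comm)
next
  show zero: "\<zero>\<^bsub>A\<^esub> \<in> carrier A"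
    by (simp add: carrier_A zero_A)
  fix f assume f: "f \<in> carrier A"
  show "\<zero>\<^bsub>A\<^esub> \<oplus>\<^bsub>A\<^esub> f = f"
    by (rule A_eqI; (intro add_A_closed f zero)?) (simp add: add_A zero_A A_apply[OF f])
qed (rule add_A_closed)

lemma monoid_A: "monoid A"
proof (rule monoidI)
  fix f assume f: "f \<in> carrier A"
  show "\<one>\<^bsub>A\<^esub> \<otimes>\<^bsub>A\<^esub> f = f"
  proof (rule A_eqI)
    fix x assume x: "x \<in> carrier G"
    have "(\<one>\<^bsub>A\<^esub> \<otimes>\<^bsub>A\<^esub> f) x =
        (\<Oplus>\<^bsub>R\<^esub>y\<in>carrier G. if y = \<one>\<^bsub>G\<^esub> then f (inv\<^bsub>G\<^esub> y \<otimes>\<^bsub>G\<^esub> x) else \<zero>\<^bsub>R\<^esub>)"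
      using f x by (auto simp: mult_A one_A of_group_def A_apply intro!: R.finsum_cong')
    also have "\<dots> = f x"
      using f x fin R.add.finprod_singleton_swap[of "\<one>\<^bsub>G\<^esub>" "carrier G" "\<lambda>y. f (inv\<^bsub>G\<^esub> y \<otimes>\<^bsub>G\<^esub> x)"]
      by (auto simp: A_apply)
    finally show "(\<one>\<^bsub>A\<^esub> \<otimes>\<^bsub>A\<^esub> f) x = f x" .
  qed (auto intro: mult_A_closed of_group_closed f simp: one_A)
  show "f \<otimes>\<^bsub>A\<^esub> \<one>\<^bsub>A\<^esub> = f"
    by (rule A_eqI) (auto intro: mult_A_closed of_group_closed f simp: one_A mult_of_group f)
qed (auto intro: mult_A_closed of_group_closed mult_A_assoc simp: one_A)

theorem ring_A: "ring A"
proof (rule ringI[OF abelian_group_A monoid_A])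
  fix f g h assume fgh: "f \<in> carrier A" "g \<in> carrier A" "h \<in> carrier A"
  note [simp] = fgh[THEN A_apply]
  show "(f \<oplus>\<^bsub>A\<^esub> g) \<otimes>\<^bsub>A\<^esub> h = f \<otimes>\<^bsub>A\<^esub> h \<oplus>\<^bsub>A\<^esub> g \<otimes>\<^bsub>A\<^esub> h"
  proof (rule A_eqI)
    fix x assume x: "x \<in> carrier G"
    have "((f \<oplus>\<^bsub>A\<^esub> g) \<otimes>\<^bsub>A\<^esub> h) x = (\<Oplus>\<^bsub>R\<^esub>y\<in>carrier G.
        f y \<otimes>\<^bsub>R\<^esub> h (inv\<^bsub>G\<^esub> y \<otimes>\<^bsub>G\<^esub> x) \<oplus>\<^bsub>R\<^esub> g y \<otimes>\<^bsub>R\<^esub> h (inv\<^bsub>G\<^esub> y \<otimes>\<^bsub>G\<^esub> x))"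
      using x by (auto simp: mult_A add_A R.l_distr simp del: R.finsum_addf intro!: R.finsum_cong')
    also have "\<dots> = (f \<otimes>\<^bsub>A\<^esub> h \<oplus>\<^bsub>A\<^esub> g \<otimes>\<^bsub>A\<^esub> h) x"
      using x by (subst R.finsum_addf) (auto simp: mult_A add_A)
    finally show "((f \<oplus>\<^bsub>A\<^esub> g) \<otimes>\<^bsub>A\<^esub> h) x = (f \<otimes>\<^bsub>A\<^esub> h \<oplus>\<^bsub>A\<^esub> g \<otimes>\<^bsub>A\<^esub> h) x" .
  qed (intro mult_A_closed add_A_closed fgh)+
  show "h \<otimes>\<^bsub>A\<^esub> (f \<oplus>\<^bsub>A\<^esub> g) = h \<otimes>\<^bsub>A\<^esub> f \<oplus>\<^bsub>A\<^esub> h \<otimes>\<^bsub>A\<^esub> g"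
  proof (rule A_eqI)
    fix x assume x: "x \<in> carrier G"
    have "(h \<otimes>\<^bsub>A\<^esub> (f \<oplus>\<^bsub>A\<^esub> g)) x = (\<Oplus>\<^bsub>R\<^esub>y\<in>carrier G.
        h y \<otimes>\<^bsub>R\<^esub> f (inv\<^bsub>G\<^esub> y \<otimes>\<^bsub>G\<^esub> x) \<oplus>\<^bsub>R\<^esub> h y \<otimes>\<^bsub>R\<^esub> g (inv\<^bsub>G\<^esub> y \<otimes>\<^bsub>G\<^esub> x))"
      using x by (auto simp: mult_A add_A R.r_distr simp del: R.finsum_addf intro!: R.finsum_cong')
    also have "\<dots> = (h \<otimes>\<^bsub>A\<^esub> f \<oplus>\<^bsub>A\<^esub> h \<otimes>\<^bsub>A\<^esub> g) x"
      using x by (subst R.finsum_addf) (auto simp: mult_A add_A)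
    finally show "(h \<otimes>\<^bsub>A\<^esub> (f \<oplus>\<^bsub>A\<^esub> g)) x = (h \<otimes>\<^bsub>A\<^esub> f \<oplus>\<^bsub>A\<^esub> h \<otimes>\<^bsub>A\<^esub> g) x" .
  qed (intro mult_A_closed add_A_closed fgh)+
qed

end

section \<open>Additive spans and rings of characteristic two\<close>

text \<open>
In characteristic two every element is its own negative, so the sums of elements of \<open>B\<close> already form
the additive subgroup generated by \<open>B\<close>; this description comes with an induction rule.
\<close>

inductive_set add_span :: "('a, 'm) ring_scheme \<Rightarrow> 'a set \<Rightarrow> 'a set" for R B where
  zero: "\<zero>\<^bsub>R\<^esub> \<in> add_span R B"
| add: "b \<in> B \<Longrightarrow> s \<in> add_span R B \<Longrightarrow> b \<oplus>\<^bsub>R\<^esub> s \<in> add_span R B"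

lemma add_span_mono: "s \<in> add_span R B \<Longrightarrow> B \<subseteq> C \<Longrightarrow> s \<in> add_span R C"
  by (induction rule: add_span.induct) (auto intro: add_span.intros)

context ring
begin

lemma add_span_closed: "s \<in> add_span R B \<Longrightarrow> B \<subseteq> carrier R \<Longrightarrow> s \<in> carrier R"
  by (induction rule: add_span.induct) auto

lemma add_span_incl: "b \<in> B \<Longrightarrow> B \<subseteq> carrier R \<Longrightarrow> b \<in> add_span R B"
  using add_span.add[OF _ add_span.zero, of b B R] by auto

lemma add_span_add:
  assumes "s \<in> add_span R B" "t \<in> add_span R B" "B \<subseteq> carrier R"
  shows "s \<oplus> t \<in> add_span R B"
  using assms(1)
proof (induction rule: add_span.induct)
  case zero
  then show ?case using assms add_span_closed by simp
next
  case (add b s)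
  have "b \<oplus> s \<oplus> t = b \<oplus> (s \<oplus> t)"
    using add assms add_span_closed by (intro a_assoc) auto
  then show ?case using add by (auto intro: add_span.add)
qed

lemma add_span_mult:
  assumes s: "s \<in> add_span R B" and t: "t \<in> add_span R C"
    and sub: "B \<subseteq> carrier R" "C \<subseteq> carrier R" "D \<subseteq> carrier R"
    and prod: "\<And>b c. b \<in> B \<Longrightarrow> c \<in> C \<Longrightarrow> b \<otimes> c \<in> add_span R D"
  shows "s \<otimes> t \<in> add_span R D"
proof -
  have one: "b \<otimes> t \<in> add_span R D" if b: "b \<in> B" for b
    using t
  proof (induction rule: add_span.induct)
    case zero
    have "b \<in> carrier R" using b sub by blast
    then show ?case by (simp add: add_span.zero)
  next
    case (add c t)
    have "b \<otimes> (c \<oplus> t) = b \<otimes> c \<oplus> b \<otimes> t"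
      using add b sub add_span_closed by (intro r_distr) auto
    then show ?case using add b sub prod add_span_add by simp
  qed
  have tc: "t \<in> carrier R" using t sub add_span_closed by blast
  show ?thesis
    using s
  proof (induction rule: add_span.induct)
    case zero
    then show ?case using tc by (auto intro: add_span.zero)
  next
    case (add b s)
    have "(b \<oplus> s) \<otimes> t = b \<otimes> t \<oplus> s \<otimes> t"
      using add tc sub add_span_closed by (intro l_distr) auto
    then show ?case using add one sub add_span_add by simp
  qed
qed

end

locale char2_ring = ring R for R (structure) +
  assumes add_self: "x \<in> carrier R \<Longrightarrow> x \<oplus> x = \<zero>"
begin

lemma add_self_left: "x \<in> carrier R \<Longrightarrow> y \<in> carrier R \<Longrightarrow> x \<oplus> (x \<oplus> y) = y"
  by (simp add: a_assoc[symmetric] add_self)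

lemma minus_eq_self: "x \<in> carrier R \<Longrightarrow> \<ominus> x = x"
  by (rule minus_equality) (auto simp: add_self)

lemma add_span_additive_subgroup:
  assumes "B \<subseteq> carrier R"
  shows "additive_subgroup (add_span R B) R"
proof (rule additive_subgroup.intro, rule add.subgroupI)
  show "add_span R B \<subseteq> carrier R" using assms add_span_closed by blast
  show "add_span R B \<noteq> {}" by (auto intro: add_span.zero)
  show "\<ominus> s \<in> add_span R B" if "s \<in> add_span R B" for s
    using that assms add_span_closed minus_eq_self by simp
  show "s \<oplus> t \<in> add_span R B" if "s \<in> add_span R B" "t \<in> add_span R B" for s t
    using that assms add_span_add by simp
qed

text \<open>
The Frobenius identity for the commuting elements \<open>h\<close> and \<open>1\<close>, by repeated squaring.
\<close>

lemma add_one_pow2: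
  assumes h: "h \<in> carrier R"
  shows "(h \<oplus> \<one>) [^] (2 ^ k :: nat) = h [^] (2 ^ k :: nat) \<oplus> \<one>"
proof (induction k)
  case 0
  then show ?case using h by simp
next
  case (Suc k)
  let ?w = "h [^] (2 ^ k :: nat)"
  have w: "?w \<in> carrier R" using h by simp
  have sq: "u [^] (2 ^ Suc k :: nat) = u [^] (2 ^ k :: nat) \<otimes> u [^] (2 ^ k :: nat)"
    if "u \<in> carrier R" for u
    using that by (simp add: nat_pow_mult mult_2)
  have "(h \<oplus> \<one>) [^] (2 ^ Suc k :: nat) = (?w \<oplus> \<one>) \<otimes> (?w \<oplus> \<one>)"
    by (simp only: sq[OF a_closed[OF h one_closed]] Suc.IH)
  also have "\<dots> = ?w \<otimes> ?w \<oplus> \<one>"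
    using w by (simp add: l_distr r_distr a_ac add_self_left)
  finally show ?case unfolding sq[OF h] .
qed

end

section \<open>The augmentation ideal as Jacobson radical\<close>

text \<open>
The group algebra enters the ideal theory only through these properties: it has characteristic two,
and the elements of the group multiply as in \<open>G\<close> and span it additively. For the last property the
coefficients have to form a prime field.
\<close>

locale char2_group_ring = char2_ring R + G: group G
  for R (structure) and G :: "('g, 'k) monoid_scheme" +
  fixes \<delta> :: "'g \<Rightarrow> 'a"
  assumes \<delta>_closed: "g \<in> carrier G \<Longrightarrow> \<delta> g \<in> carrier R"
    and \<delta>_mult: "g \<in> carrier G \<Longrightarrow> h \<in> carrier G \<Longrightarrow> \<delta> (g \<otimes>\<^bsub>G\<^esub> h) = \<delta> g \<otimes> \<delta> h"
    and \<delta>_one: "\<delta> \<one>\<^bsub>G\<^esub> = \<one>"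
    and carrier_span: "carrier R = add_span R (\<delta> ` carrier G)"
    and one_not_zero: "\<one> \<noteq> \<zero>"
begin

definition augmentation :: "'a set" where
  "augmentation = add_span R ((\<lambda>g. \<delta> g \<oplus> \<one>) ` carrier G)"

lemma gens_closed: "\<delta> ` carrier G \<subseteq> carrier R" "(\<lambda>g. \<delta> g \<oplus> \<one>) ` carrier G \<subseteq> carrier R"
  using \<delta>_closed by auto

lemma augmentation_closed: "i \<in> augmentation \<Longrightarrow> i \<in> carrier R"
  unfolding augmentation_def by (rule add_span_closed[OF _ gens_closed(2)])

lemma augmentation_gen: "g \<in> carrier G \<Longrightarrow> \<delta> g \<oplus> \<one> \<in> augmentation"
  unfolding augmentation_def by (rule add_span_incl[OF _ gens_closed(2)]) (rule imageI)

lemma augmentation_add: "i \<in> augmentation \<Longrightarrow> j \<in> augmentation \<Longrightarrow> i \<oplus> j \<in> augmentation"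
  unfolding augmentation_def by (rule add_span_add[OF _ _ gens_closed(2)])

text \<open>
The augmentation ideal has index two: adding one more group element \<open>g = (g + 1) + 1\<close> to a sum
exchanges its two cosets.
\<close>

lemma augmentation_dichotomy:
  assumes "f \<in> carrier R"
  shows "f \<in> augmentation \<or> f \<oplus> \<one> \<in> augmentation"
proof -
  have "f \<in> add_span R (\<delta> ` carrier G)"
    using assms carrier_span by blast
  then show ?thesis
  proof (induction rule: add_span.induct)
    case zero
    then show ?case by (simp add: augmentation_def add_span.zero)
  next
    case (add d s)
    then obtain g where g: "g \<in> carrier G" "d = \<delta> g" by blast
    have s: "s \<in> carrier R" using add carrier_span by blast
    have "(\<delta> g \<oplus> \<one>) \<oplus> s = (d \<oplus> s) \<oplus> \<one>" "(\<delta> g \<oplus> \<one>) \<oplus> (s \<oplus> \<one>) = d \<oplus> s"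
      using s g \<delta>_closed[OF g(1)] by (simp_all add: a_ac add_self_left)
    then show ?case
      using add.IH augmentation_add[OF augmentation_gen[OF g(1)]] by metis
  qed
qed

text \<open>
On generators, \<open>h (g + 1) = (h g + 1) + (h + 1)\<close>.
\<close>

lemma augmentation_left_ideal: "left_ideal augmentation R"
  unfolding left_ideal_def
proof (intro conjI ballI)
  show "additive_subgroup augmentation R"
    unfolding augmentation_def by (rule add_span_additive_subgroup[OF gens_closed(2)])
  fix f i assume f: "f \<in> carrier R" and i: "i \<in> augmentation"
  show "f \<otimes> i \<in> augmentation"
    unfolding augmentation_def
  proof (rule add_span_mult)
    show "f \<in> add_span R (\<delta> ` carrier G)" using f carrier_span by blast
    show "i \<in> add_span R ((\<lambda>g. \<delta> g \<oplus> \<one>) ` carrier G)" using i by (simp add: augmentation_def)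
    fix d e assume "d \<in> \<delta> ` carrier G" "e \<in> (\<lambda>g. \<delta> g \<oplus> \<one>) ` carrier G"
    then obtain h g where hg: "h \<in> carrier G" "d = \<delta> h" "g \<in> carrier G" "e = \<delta> g \<oplus> \<one>"
      by blast
    have "\<delta> h \<in> carrier R" "\<delta> g \<in> carrier R" using hg \<delta>_closed by auto
    then have "d \<otimes> e = (\<delta> (h \<otimes>\<^bsub>G\<^esub> g) \<oplus> \<one>) \<oplus> (\<delta> h \<oplus> \<one>)"
      unfolding hg(2,4) \<delta>_mult[OF hg(1,3)]
      by (simp add: r_distr a_ac add_self_left add_self)
    then show "d \<otimes> e \<in> add_span R ((\<lambda>g. \<delta> g \<oplus> \<one>) ` carrier G)"
      using hg augmentation_gen augmentation_add by (simp add: augmentation_def)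
  qed (use gens_closed in blast)+
qed

lemma augmentation_pow:
  assumes i: "i \<in> augmentation"
  shows "i [^] n \<in> ideal_power R augmentation n"
proof (induction n)
  case 0
  then show ?case using augmentation_closed[OF i] by simp
next
  case (Suc n)
  from ideal_prod.prod[OF Suc i] show ?case by simp
qed

lemma zero_in_ideal_power: "\<zero> \<in> ideal_power R augmentation n"
proof (induction n)
  case (Suc n)
  have "\<zero> \<otimes> \<zero> \<in> ideal_prod R (ideal_power R augmentation n) augmentation"
    by (rule ideal_prod.prod[OF Suc]) (simp add: augmentation_def add_span.zero)
  then show ?case by simp
qed simp

text \<open>
Once it is nilpotent, the augmentation ideal is the only maximal left ideal. Indeed, a left ideal
\<open>K\<close> not contained in it contains some \<open>1 + i\<close> with \<open>i\<close> in the augmentation ideal. Then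
\<open>1 + i\<^sup>n\<close> is in \<open>K\<close> for all \<open>n\<close>, and hence so is \<open>1\<close>.
\<close>

lemma jacobson_radical_eq_augmentation:
  assumes nil: "ideal_power R augmentation N = {\<zero>}"
  shows "jacobson_radical R = augmentation"
proof -
  have nilpotent: "i [^] N = \<zero>" if "i \<in> augmentation" for i
    using augmentation_pow[OF that, of N] nil by simp
  have proper: "\<one> \<notin> augmentation"
    using nilpotent[of \<one>] one_not_zero by auto
  have top: "K = carrier R" if K: "left_ideal K R" and nsub: "\<not> K \<subseteq> augmentation" for K
  proof -
    interpret K: additive_subgroup K R using K by (simp add: left_ideal_def)
    have Kl: "r \<otimes> k \<in> K" if "r \<in> carrier R" "k \<in> K" for r k
      using K that by (simp add: left_ideal_def)
    obtain k where k: "k \<in> K" "k \<notin> augmentation" using nsub by blast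
    have kc: "k \<in> carrier R" using k(1) by (rule K.a_Hcarr)
    define i where "i = k \<oplus> \<one>"
    have i: "i \<in> augmentation" using augmentation_dichotomy[OF kc] k by (simp add: i_def)
    have ic: "i \<in> carrier R" using kc by (simp add: i_def)
    have ik: "i \<oplus> \<one> = k" using kc by (simp add: i_def a_assoc add_self)
    \<comment> \<open>Modulo \<open>K\<close> the element \<open>i\<close> is one, and \<open>K\<close> absorbs multiplication from the left.\<close>
    have "i [^] n \<oplus> \<one> \<in> K" for n :: nat
    proof (induction n)
      case 0
      then show ?case by (simp add: add_self)
    next
      case (Suc n)
      have "i [^] Suc n \<oplus> \<one> = i \<otimes> (i [^] n \<oplus> \<one>) \<oplus> (i \<oplus> \<one>)"
        using ic nat_pow_Suc2[OF ic, of n] by (simp add: r_distr a_ac add_self_left)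
      then show ?case using Kl[OF ic Suc] k ik K.a_closed by simp
    qed
    from this[of N] have "\<one> \<in> K" using nilpotent[OF i] by simp
    then have "r \<in> K" if "r \<in> carrier R" for r
      using Kl[OF that] that by force
    then show ?thesis using K.a_subset by blast
  qed
  have max: "maximal_left_ideal M R \<longleftrightarrow> M = augmentation" for M
  proof
    assume M: "maximal_left_ideal M R"
    then have "M \<subseteq> augmentation"
      using top[of M] by (auto simp: maximal_left_ideal_def)
    with M augmentation_left_ideal proper show "M = augmentation"
      by (metis maximal_left_ideal_def one_closed)
  next
    assume "M = augmentation"
    then show "maximal_left_ideal M R"
      using augmentation_left_ideal proper top one_closed by (metis maximal_left_ideal_def subset_antisym)
  qed
  have "augmentation \<subseteq> carrier R" using augmentation_closed by blast
  then show ?thesis by (auto simp: jacobson_radical_def max)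
qed

text \<open>
A descending chain that starts at the whole ring and on which every \<open>g + 1\<close> acts from the right with
degree one bounds the powers of the augmentation ideal from above. Multiplication from the right
suits the recursion of \<^const>\<open>ideal_power\<close>.
\<close>

lemma ideal_power_subset_filtration:
  fixes F :: "nat \<Rightarrow> 'a set"
  assumes one: "\<one> \<in> F 0"
    and zero: "\<And>d. \<zero> \<in> F d"
    and add: "\<And>d f h. f \<in> F d \<Longrightarrow> h \<in> F d \<Longrightarrow> f \<oplus> h \<in> F d"
    and closed: "\<And>d. F d \<subseteq> carrier R"
    and decr: "\<And>d. F (Suc d) \<subseteq> F d"
    and step: "\<And>d f g. f \<in> F d \<Longrightarrow> g \<in> carrier G \<Longrightarrow> f \<otimes> (\<delta> g \<oplus> \<one>) \<in> F (Suc d)"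
  shows "ideal_power R augmentation n \<subseteq> F n"
proof (induction n)
  case 0
  have "\<delta> g \<in> F 0" if g: "g \<in> carrier G" for g
  proof -
    have "\<delta> g \<oplus> \<one> \<in> F 0" using step[OF one g] decr \<delta>_closed[OF g] by auto
    from add[OF this one] show ?thesis
      using \<delta>_closed[OF g] by (simp add: a_assoc add_self)
  qed
  note \<delta>_F = this
  have "f \<in> F 0" if "f \<in> add_span R (\<delta> ` carrier G)" for f
    using that
  proof (induction rule: add_span.induct)
    case zero
    show ?case by (rule assms(2))
  next
    case (add d s)
    then show ?case using \<delta>_F by (auto intro: assms(3))
  qed
  then show ?case using carrier_span by auto
next
  case (Suc n)
  have aug: "f \<otimes> i \<in> F (Suc n)" if f: "f \<in> F n" and i: "i \<in> augmentation" for f i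
    using i unfolding augmentation_def
  proof (induction rule: add_span.induct)
    case zero
    then show ?case using f closed assms(2) by fastforce
  next
    case (add d s)
    have "s \<in> carrier R" using add gens_closed add_span_closed by blast
    then have "f \<otimes> (d \<oplus> s) = f \<otimes> d \<oplus> f \<otimes> s"
      using f closed add gens_closed by (intro r_distr) blast+
    then show ?case using add step[OF f] assms(3) by auto
  qed
  have "f \<in> F (Suc n)" if "f \<in> ideal_prod R (ideal_power R augmentation n) augmentation" for f
    using that by (induction rule: ideal_prod.induct) (use Suc aug add in auto)
  then show ?case by auto
qed

end

section \<open>Weights of monomials\<close>

text \<open>
The relations between \<open>a\<close>, \<open>b\<close>, \<open>c\<close> are those of the four families; \<open>ab\<close> and \<open>cb\<close> say that
\<open>[a, b] = a\<^sup>2\<^sup>s c\<close> and \<open>[c, b] = a\<^sup>4\<^sup>t\<close>. The generators \<open>a + 1\<close> and \<open>b + 1\<close> will have weight one and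
\<open>c + 1\<close> weight two. The exponents \<open>2 s\<close> and \<open>4 t\<close> make each commutator plus one at least one step
heavier than the corresponding generator \<open>a + 1\<close> or \<open>c + 1\<close>.
\<close>

locale monomial_filtration = char2_ring R for R (structure) +
  fixes a b c :: 'a and \<alpha> \<beta> \<kappa> s t :: nat
  assumes abc: "a \<in> carrier R" "b \<in> carrier R" "c \<in> carrier R"
    and ca: "c \<otimes> a = a \<otimes> c"
    and ab: "a \<otimes> b = b \<otimes> (a \<otimes> (a [^] (2 * s) \<otimes> c))"
    and cb: "c \<otimes> b = b \<otimes> (c \<otimes> a [^] (4 * t))"
    and pow_a: "a [^] (2 ^ \<alpha> :: nat) = \<one>"
    and pow_c: "c [^] (2 ^ \<kappa> :: nat) = \<one>"
    and pow_b: "b [^] (2 ^ \<beta> :: nat) \<in> {\<one>, a [^] (2 ^ \<beta> :: nat)}"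
begin

definition "\<xi> = a \<oplus> \<one>"
definition "\<eta> = b \<oplus> \<one>"
definition "\<zeta> = c \<oplus> \<one>"

lemma \<xi>\<eta>\<zeta>_closed [simp]: "\<xi> \<in> carrier R" "\<eta> \<in> carrier R" "\<zeta> \<in> carrier R"
  using abc by (simp_all add: \<xi>_def \<eta>_def \<zeta>_def)

lemma commute_\<zeta>\<xi>: "\<zeta> \<otimes> \<xi> = \<xi> \<otimes> \<zeta>"
  using abc ca by (simp add: \<xi>_def \<zeta>_def l_distr r_distr a_ac)

lemma commute_pow:
  assumes "u \<in> carrier R" "v \<in> carrier R" "u \<otimes> v = v \<otimes> u"
  shows "u [^] (k::nat) \<otimes> v = v \<otimes> u [^] k"
proof (induction k)
  case (Suc k)
  have "u [^] Suc k \<otimes> v = u [^] k \<otimes> (v \<otimes> u)"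
    using assms by (simp add: m_assoc)
  also have "\<dots> = (u [^] k \<otimes> v) \<otimes> u"
    using assms by (simp add: m_assoc)
  finally show ?case using assms Suc by (simp add: m_assoc)
qed (use assms in simp)

lemma commute_\<zeta>\<xi>_pow: "\<zeta> [^] (k::nat) \<otimes> \<xi> [^] (i::nat) = \<xi> [^] i \<otimes> \<zeta> [^] k"
  using commute_pow[OF _ _ commute_pow[of \<xi> \<zeta> i, symmetric], of k] commute_\<zeta>\<xi> by simp

text \<open>
The filtration \<open>W\<close> lives in the commutative subring generated by \<open>a\<close> and \<open>c\<close>. It is multiplicative,
and \<open>F\<close> arises from it by putting powers of \<open>\<eta>\<close> in front.
\<close>

abbreviation "W_gens d \<equiv> {\<xi> [^] i \<otimes> \<zeta> [^] k | i k :: nat. d \<le> i + 2 * k}"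
abbreviation "F_gens d \<equiv> {\<eta> [^] j \<otimes> (\<xi> [^] i \<otimes> \<zeta> [^] k) | j i k :: nat. d \<le> j + i + 2 * k}"

definition W :: "nat \<Rightarrow> 'a set" where "W d = add_span R (W_gens d)"
definition F :: "nat \<Rightarrow> 'a set" where "F d = add_span R (F_gens d)"

lemma W_gens_closed: "W_gens d \<subseteq> carrier R" by auto
lemma F_gens_closed: "F_gens d \<subseteq> carrier R" by auto

lemma W_closed: "w \<in> W d \<Longrightarrow> w \<in> carrier R"
  unfolding W_def by (rule add_span_closed[OF _ W_gens_closed])
lemma F_closed: "w \<in> F d \<Longrightarrow> w \<in> carrier R"
  unfolding F_def by (rule add_span_closed[OF _ F_gens_closed])
lemma W_add: "v \<in> W d \<Longrightarrow> w \<in> W d \<Longrightarrow> v \<oplus> w \<in> W d"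
  unfolding W_def by (rule add_span_add[OF _ _ W_gens_closed])
lemma F_add: "v \<in> F d \<Longrightarrow> w \<in> F d \<Longrightarrow> v \<oplus> w \<in> F d"
  unfolding F_def by (rule add_span_add[OF _ _ F_gens_closed])
lemma W_zero: "\<zero> \<in> W d" and F_zero: "\<zero> \<in> F d"
  by (simp_all add: W_def F_def add_span.zero)
lemma W_antimono: "w \<in> W d \<Longrightarrow> d' \<le> d \<Longrightarrow> w \<in> W d'"
  unfolding W_def by (erule add_span_mono) (auto intro: le_trans)
lemma F_antimono: "w \<in> F d \<Longrightarrow> d' \<le> d \<Longrightarrow> w \<in> F d'"
  unfolding F_def by (erule add_span_mono) (auto intro: le_trans)

lemma W_monomial: "d \<le> i + 2 * k \<Longrightarrow> \<xi> [^] i \<otimes> \<zeta> [^] (k::nat) \<in> W d"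
  unfolding W_def by (intro add_span_incl W_gens_closed) auto
lemma F_monomial: "d \<le> j + i + 2 * k \<Longrightarrow> \<eta> [^] j \<otimes> (\<xi> [^] i \<otimes> \<zeta> [^] (k::nat)) \<in> F d"
  unfolding F_def by (intro add_span_incl F_gens_closed) auto

lemma W_mult:
  assumes "v \<in> W m" "w \<in> W n"
  shows "v \<otimes> w \<in> W (m + n)"
  unfolding W_def
proof (rule add_span_mult)
  fix f h assume "f \<in> W_gens m" "h \<in> W_gens n"
  then obtain i k i' k' :: nat where
    fh: "f = \<xi> [^] i \<otimes> \<zeta> [^] k" "h = \<xi> [^] i' \<otimes> \<zeta> [^] k'" "m \<le> i + 2 * k" "n \<le> i' + 2 * k'"
    by blast
  have "f \<otimes> h = \<xi> [^] i \<otimes> (\<zeta> [^] k \<otimes> \<xi> [^] i') \<otimes> \<zeta> [^] k'"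
    by (simp add: fh m_assoc)
  also have "\<dots> = \<xi> [^] (i + i') \<otimes> \<zeta> [^] (k + k')"
    by (simp add: commute_\<zeta>\<xi>_pow m_assoc nat_pow_mult[symmetric])
  finally show "f \<otimes> h \<in> add_span R (W_gens (m + n))"
    using W_monomial[of "m + n" "i + i'" "k + k'"] fh by (simp add: W_def)
qed (use assms in \<open>auto simp: W_def\<close>)

lemma \<eta>_pow_W:
  assumes "w \<in> W n"
  shows "\<eta> [^] j \<otimes> w \<in> F (j + n)"
  unfolding F_def
proof (rule add_span_mult)
  show "\<eta> [^] j \<in> add_span R {\<eta> [^] j}" by (intro add_span_incl) auto
  show "w \<in> add_span R (W_gens n)" using assms by (simp add: W_def)
  fix f h assume "f \<in> {\<eta> [^] j}" "h \<in> W_gens n"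
  then show "f \<otimes> h \<in> add_span R (F_gens (j + n))"
    using F_monomial[of "j + n" j] by (auto simp: F_def)
qed auto

text \<open>
Elements of \<open>W d\<close> that can be moved past \<open>\<eta>\<close> up to a term of weight \<open>d + 1\<close> without \<open>\<eta>\<close>. The leading
coefficient \<open>p\<close> may differ from \<open>w\<close>, since \<open>b\<close> acts on the subgroup by conjugation. This
property is closed under products, so that it has to be checked for \<open>\<xi>\<close> and \<open>\<zeta>\<close> only.
\<close>

definition movable :: "nat \<Rightarrow> 'a \<Rightarrow> bool" where
  "movable d w \<longleftrightarrow> w \<in> W d \<and> (\<exists>p\<in>W d. \<exists>q\<in>W (Suc d). w \<otimes> \<eta> = \<eta> \<otimes> p \<oplus> q)"

lemma movable_mult:
  assumes "movable m v" "movable n w"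
  shows "movable (m + n) (v \<otimes> w)"
proof -
  from assms obtain p q p' q' where
    v: "v \<in> W m" "p \<in> W m" "q \<in> W (Suc m)" "v \<otimes> \<eta> = \<eta> \<otimes> p \<oplus> q" and
    w: "w \<in> W n" "p' \<in> W n" "q' \<in> W (Suc n)" "w \<otimes> \<eta> = \<eta> \<otimes> p' \<oplus> q'"
    unfolding movable_def by blast
  note [simp] = v(1-3)[THEN W_closed] w(1-3)[THEN W_closed]
  have "(v \<otimes> w) \<otimes> \<eta> = v \<otimes> (\<eta> \<otimes> p' \<oplus> q')"
    by (simp add: m_assoc w(4))
  also have "\<dots> = (v \<otimes> \<eta>) \<otimes> p' \<oplus> v \<otimes> q'"
    by (simp add: r_distr m_assoc)
  also have "\<dots> = \<eta> \<otimes> (p \<otimes> p') \<oplus> (q \<otimes> p' \<oplus> v \<otimes> q')"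
    by (simp add: v(4) l_distr m_assoc a_assoc)
  finally have "(v \<otimes> w) \<otimes> \<eta> = \<eta> \<otimes> (p \<otimes> p') \<oplus> (q \<otimes> p' \<oplus> v \<otimes> q')" .
  moreover have "q \<otimes> p' \<oplus> v \<otimes> q' \<in> W (Suc (m + n))"
    using W_mult[OF v(3) w(2)] W_mult[OF v(1) w(3)] by (simp add: W_add)
  ultimately show ?thesis
    unfolding movable_def using W_mult[OF v(1) w(1)] W_mult[OF v(2) w(2)] by blast
qed

lemma movable_one: "movable 0 \<one>"
proof -
  have "\<one> \<in> W 0" using W_monomial[of 0 0 0] by simp
  then show ?thesis
    unfolding movable_def using W_zero[of "Suc 0"] by (intro conjI bexI[of _ \<one>] bexI[of _ \<zero>]) auto
qed

lemma movable_pow: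
  assumes "movable d w"
  shows "movable (k * d) (w [^] k)"
proof (induction k)
  case 0
  then show ?case by (simp add: movable_one)
next
  case (Suc k)
  then show ?case using movable_mult[OF Suc assms] by (simp add: add.commute)
qed

text \<open>
For commuting \<open>h\<close> and \<open>b\<close> the element \<open>h + 1\<close> just commutes with \<open>\<eta>\<close>. In general the error
is \<open>h (u + 1)\<close>, where \<open>u\<close> plays the role of the commutator \<open>[h, b]\<close>, so \<open>u + 1\<close>
has to be heavier than \<open>h + 1\<close>.
\<close>

lemma movable_grouplike:
  assumes h: "h \<in> carrier R" "h \<oplus> \<one> \<in> W d"
    and u: "u \<in> carrier R" "u \<oplus> \<one> \<in> W (Suc d)"
    and hb: "h \<otimes> b = b \<otimes> (h \<otimes> u)"
  shows "movable d (h \<oplus> \<one>)"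
proof -
  have one: "\<one> \<in> W 0" using movable_one by (simp add: movable_def)
  have "(h \<oplus> \<one>) \<oplus> \<one> \<in> W 0" using h(2) one W_antimono W_add by blast
  then have "h \<in> W 0" using h(1) by (simp add: a_assoc add_self)
  with u(2) have q: "h \<otimes> (u \<oplus> \<one>) \<in> W (Suc d)" using W_mult by fastforce
  have "h \<otimes> (u \<oplus> \<one>) \<oplus> (h \<oplus> \<one>) \<in> W d"
    using q h W_add W_antimono by (meson le_SucI order_refl)
  moreover have "(h \<oplus> \<one>) \<otimes> \<eta> = \<eta> \<otimes> (h \<otimes> (u \<oplus> \<one>) \<oplus> (h \<oplus> \<one>)) \<oplus> h \<otimes> (u \<oplus> \<one>)"
    using h(1) u(1) abc
    by (simp add: \<eta>_def l_distr r_distr a_ac add_self_left add_self hb)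
  ultimately show ?thesis
    unfolding movable_def using h q by blast
qed

text \<open>
The identity \<open>g h + 1 = (g + 1) (h + 1) + (g + 1) + (h + 1)\<close> shows that the elements \<open>g\<close> of the group
with \<open>g + 1\<close> of weight \<open>d\<close> are closed under products.
\<close>

lemma W_grouplike_mult:
  assumes "g \<in> carrier R" "h \<in> carrier R" "g \<oplus> \<one> \<in> W d" "h \<oplus> \<one> \<in> W d"
  shows "g \<otimes> h \<oplus> \<one> \<in> W d"
proof -
  have "g \<otimes> h \<oplus> \<one> = (g \<oplus> \<one>) \<otimes> (h \<oplus> \<one>) \<oplus> ((g \<oplus> \<one>) \<oplus> (h \<oplus> \<one>))"
    using assms by (simp add: l_distr r_distr a_ac add_self_left add_self)
  moreover have "(g \<oplus> \<one>) \<otimes> (h \<oplus> \<one>) \<in> W d"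
    using W_mult[OF assms(3,4)] by (rule W_antimono) simp
  ultimately show ?thesis using assms W_add by simp
qed

lemma W_grouplike_pow:
  assumes "g \<in> carrier R" "g \<oplus> \<one> \<in> W d"
  shows "g [^] (k::nat) \<oplus> \<one> \<in> W d"
  by (induction k) (use assms in \<open>auto simp: add_self W_zero intro!: W_grouplike_mult\<close>)

text \<open>
Squaring doubles the weight, as \<open>a\<close> to the power \<open>2\<^sup>k\<close>, plus one, is \<open>\<xi>\<close> to the power \<open>2\<^sup>k\<close>.
\<close>

lemma a_pow_mult_pow2: "a [^] (2 ^ k * n :: nat) \<oplus> \<one> \<in> W (2 ^ k)"
proof -
  have "a [^] (2 ^ k :: nat) \<oplus> \<one> = \<xi> [^] (2 ^ k :: nat)"
    using add_one_pow2[OF abc(1), of k] by (simp add: \<xi>_def)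
  also have "\<dots> \<in> W (2 ^ k)"
    using W_monomial[of "2 ^ k" "2 ^ k" 0] by simp
  finally show ?thesis
    using W_grouplike_pow[of "a [^] (2 ^ k :: nat)"] abc by (simp add: nat_pow_pow)
qed

lemma movable_\<xi>: "movable 1 \<xi>" and movable_\<zeta>: "movable 2 \<zeta>"
proof -
  have \<zeta>: "\<zeta> \<in> W 2" using W_monomial[of 2 0 1] by simp
  have \<xi>: "\<xi> \<in> W 1" using W_monomial[of 1 1 0] by simp
  have "a [^] (2 * s) \<otimes> c \<oplus> \<one> \<in> W (Suc 1)"
    using W_grouplike_mult[of "a [^] (2 * s)" c 2] a_pow_mult_pow2[of 1 s] \<zeta> abc
    by (simp add: \<zeta>_def numeral_2_eq_2)
  then show "movable 1 \<xi>"
    using movable_grouplike[of a 1 "a [^] (2 * s) \<otimes> c"] \<xi> abc ab by (simp add: \<xi>_def)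
  have "a [^] (4 * t) \<oplus> \<one> \<in> W (Suc 2)"
    using a_pow_mult_pow2[of 2 t] by (intro W_antimono[of _ 4 "Suc 2"]) auto
  then show "movable 2 \<zeta>"
    using movable_grouplike[of c 2 "a [^] (4 * t)"] \<zeta> abc cb by (simp add: \<zeta>_def)
qed

text \<open>
Moving the new factor \<open>\<eta>\<close> to the front of \<open>\<eta>\<^sup>j w\<close> gives \<open>\<eta>\<^sup>j\<^sup>+\<^sup>1 p + \<eta>\<^sup>j q\<close>. The first term gains a
factor \<open>\<eta>\<close>, and in the second one the coefficient has become heavier.
\<close>

lemma F_step_\<eta>:
  assumes "f \<in> F d"
  shows "f \<otimes> \<eta> \<in> F (Suc d)"
  unfolding F_def
proof (rule add_span_mult)
  show "f \<in> add_span R (F_gens d)" using assms by (simp add: F_def)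
  show "\<eta> \<in> add_span R {\<eta>}" by (intro add_span_incl) auto
  fix h y assume "h \<in> F_gens d" "y \<in> {\<eta>}"
  then obtain j i k :: nat where
    hy: "h = \<eta> [^] j \<otimes> (\<xi> [^] i \<otimes> \<zeta> [^] k)" "d \<le> j + i + 2 * k" "y = \<eta>" by blast
  let ?n = "i + 2 * k"
  let ?w = "\<xi> [^] i \<otimes> \<zeta> [^] k"
  have "movable ?n ?w"
    using movable_mult[OF movable_pow[OF movable_\<xi>] movable_pow[OF movable_\<zeta>], of i k]
    by (simp add: mult.commute)
  then obtain p q where pq: "p \<in> W ?n" "q \<in> W (Suc ?n)" "?w \<otimes> \<eta> = \<eta> \<otimes> p \<oplus> q"
    unfolding movable_def by blast
  have [simp]: "p \<in> carrier R" "q \<in> carrier R" using pq W_closed by auto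
  have "h \<otimes> y = \<eta> [^] j \<otimes> (?w \<otimes> \<eta>)" by (simp add: hy m_assoc)
  also have "\<dots> = \<eta> [^] Suc j \<otimes> p \<oplus> \<eta> [^] j \<otimes> q"
    by (simp add: pq(3) r_distr m_assoc)
  also have "\<dots> \<in> F (Suc d)"
    using \<eta>_pow_W[OF pq(1), of "Suc j"] \<eta>_pow_W[OF pq(2), of j] hy(2)
    by (intro F_add) (auto elim!: F_antimono)
  finally show "h \<otimes> y \<in> add_span R (F_gens (Suc d))" by (simp add: F_def)
qed auto

lemma F_step_W:
  assumes "f \<in> F d" "w \<in> W n"
  shows "f \<otimes> w \<in> F (d + n)"
  unfolding F_def
proof (rule add_span_mult)
  show "f \<in> add_span R (F_gens d)" using assms by (simp add: F_def)
  show "w \<in> add_span R (W_gens n)" using assms by (simp add: W_def)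
  fix h v assume "h \<in> F_gens d" "v \<in> W_gens n"
  then obtain j i k :: nat where
    h: "h = \<eta> [^] j \<otimes> (\<xi> [^] i \<otimes> \<zeta> [^] k)" "d \<le> j + i + 2 * k" and v: "v \<in> W n"
    using add_span_incl[OF _ W_gens_closed] by (fastforce simp: W_def)
  have "h \<otimes> v = \<eta> [^] j \<otimes> ((\<xi> [^] i \<otimes> \<zeta> [^] k) \<otimes> v)"
    using W_closed[OF v] by (simp add: h m_assoc)
  also have "\<dots> \<in> F (j + ((i + 2 * k) + n))"
    by (intro \<eta>_pow_W W_mult W_monomial v) simp
  finally show "h \<otimes> v \<in> add_span R (F_gens (d + n))"
    using h(2) by (auto simp: F_def[symmetric] elim!: F_antimono)
qed auto

text \<open>
As \<open>g h + 1 = (g + 1) (h + 1) + (g + 1) + (h + 1)\<close>, the elements that raise weights are closed under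
products, and it suffices to consider the generators of the group.
\<close>

definition raising :: "'a set" where
  "raising = {g \<in> carrier R. \<forall>d. \<forall>f\<in>F d. f \<otimes> (g \<oplus> \<one>) \<in> F (Suc d)}"

lemma raising_mult:
  assumes "g \<in> raising" "h \<in> raising"
  shows "g \<otimes> h \<in> raising"
proof -
  have [simp]: "g \<in> carrier R" "h \<in> carrier R" using assms by (auto simp: raising_def)
  have "f \<otimes> (g \<otimes> h \<oplus> \<one>) \<in> F (Suc d)" if f: "f \<in> F d" for f d
  proof -
    have [simp]: "f \<in> carrier R" using f F_closed by blast
    have g: "f \<otimes> (g \<oplus> \<one>) \<in> F (Suc d)" and h: "f \<otimes> (h \<oplus> \<one>) \<in> F (Suc d)"
      using assms f by (auto simp: raising_def)
    have "f \<otimes> (g \<otimes> h \<oplus> \<one>) =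
        f \<otimes> (g \<oplus> \<one>) \<otimes> (h \<oplus> \<one>) \<oplus> (f \<otimes> (g \<oplus> \<one>) \<oplus> f \<otimes> (h \<oplus> \<one>))"
      by (simp add: l_distr r_distr m_assoc a_ac add_self_left add_self)
    moreover have "f \<otimes> (g \<oplus> \<one>) \<otimes> (h \<oplus> \<one>) \<in> F (Suc (Suc d))"
      using g assms by (auto simp: raising_def)
    ultimately show ?thesis using g h F_add F_antimono[of _ "Suc (Suc d)" "Suc d"] by simp
  qed
  then show ?thesis by (simp add: raising_def)
qed

lemma raising_one: "\<one> \<in> raising"
  by (auto simp: raising_def add_self F_zero F_closed)

lemma raising_pow: "g \<in> raising \<Longrightarrow> g [^] (k::nat) \<in> raising"
  by (induction k) (auto intro: raising_one raising_mult)

lemma raising_abc: "a \<in> raising" "b \<in> raising" "c \<in> raising"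
proof -
  have "\<xi> \<in> W 1" "\<zeta> \<in> W 1"
    using movable_\<xi> movable_\<zeta> W_antimono[of \<zeta> 2 1] by (auto simp: movable_def)
  then show "a \<in> raising" "b \<in> raising" "c \<in> raising"
    using F_step_\<eta> F_step_W[of _ _ _ 1] abc
    by (auto simp: raising_def \<xi>_def[symmetric] \<eta>_def[symmetric] \<zeta>_def[symmetric])
qed

lemma F_zero_level: "\<one> \<in> F 0"
  using F_monomial[of 0 0 0 0] by simp

lemma pow_eq_zero:
  assumes "w \<in> carrier R" "w [^] (m::nat) = \<zero>" "m \<le> n"
  shows "w [^] n = \<zero>"
  using nat_pow_mult[OF assms(1), of m "n - m"] assms by simp

text \<open>
If neither \<open>i \<ge> 2\<^sup>\<alpha>\<close> nor \<open>k \<ge> 2\<^sup>\<kappa>\<close>, the weight forces \<open>j \<ge> 2\<^sup>\<beta>\<close>. Then \<open>2\<^sup>\<beta>\<close> factors \<open>\<eta>\<close> can be replaced by zero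
or by the same number of factors \<open>\<xi>\<close>. This keeps the weight and decreases \<open>j\<close>. The constant 3
is written on the right of the bound to avoid truncated subtraction.
\<close>

lemma monomial_vanishes:
  assumes "2 ^ \<alpha> + 2 ^ \<beta> + 2 * 2 ^ \<kappa> \<le> j + i + 2 * k + 3"
  shows "\<eta> [^] j \<otimes> (\<xi> [^] i \<otimes> \<zeta> [^] (k::nat)) = \<zero>"
  using assms
proof (induction j arbitrary: i rule: less_induct)
  case (less j)
  have X0: "\<xi> [^] (2 ^ \<alpha> :: nat) = \<zero>"
    using add_one_pow2[OF abc(1), of \<alpha>] by (simp add: \<xi>_def pow_a add_self)
  have Z0: "\<zeta> [^] (2 ^ \<kappa> :: nat) = \<zero>"
    using add_one_pow2[OF abc(3), of \<kappa>] by (simp add: \<zeta>_def pow_c add_self)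
  have Y0: "\<eta> [^] (2 ^ \<beta> :: nat) \<in> {\<zero>, \<xi> [^] (2 ^ \<beta> :: nat)}"
    using add_one_pow2[OF abc(2), of \<beta>] add_one_pow2[OF abc(1), of \<beta>] pow_b
    by (auto simp: \<xi>_def \<eta>_def add_self)
  show ?case
  proof (cases "2 ^ \<alpha> \<le> i \<or> 2 ^ \<kappa> \<le> k")
    case True
    then show ?thesis
      using pow_eq_zero[OF _ X0, of i] pow_eq_zero[OF _ Z0, of k] by auto
  next
    case False
    then have i: "i + 1 \<le> 2 ^ \<alpha>" and k: "k + 1 \<le> 2 ^ \<kappa>" by auto
    with less.prems have j: "2 ^ \<beta> \<le> j" by linarith
    let ?j = "j - 2 ^ \<beta>"
    have "\<eta> [^] j = \<eta> [^] ?j \<otimes> \<eta> [^] (2 ^ \<beta> :: nat)"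
      using j by (simp add: nat_pow_mult)
    then have eq: "\<eta> [^] j \<otimes> (\<xi> [^] i \<otimes> \<zeta> [^] k) =
        \<eta> [^] ?j \<otimes> (\<eta> [^] (2 ^ \<beta> :: nat) \<otimes> \<xi> [^] i \<otimes> \<zeta> [^] k)"
      by (simp add: m_assoc)
    show ?thesis
    proof (cases "\<eta> [^] (2 ^ \<beta> :: nat) = \<zero>")
      case True
      then show ?thesis by (simp add: eq)
    next
      case False
      then have "\<eta> [^] (2 ^ \<beta> :: nat) \<otimes> \<xi> [^] i = \<xi> [^] (2 ^ \<beta> + i)"
        using Y0 by (simp add: nat_pow_mult)
      moreover have "?j < j" using j by (simp add: order_less_le_trans[of 0 "2 ^ \<beta>"])
      ultimately show ?thesis
        using less.IH[of ?j "2 ^ \<beta> + i"] less.prems j by (simp add: eq)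
    qed
  qed
qed

lemma F_top:
  assumes "2 ^ \<alpha> + 2 ^ \<beta> + 2 * 2 ^ \<kappa> \<le> d + 3"
  shows "F d = {\<zero>}"
proof -
  have "F_gens d \<subseteq> {\<zero>}" using monomial_vanishes assms by fastforce
  then have "F d \<subseteq> add_span R {\<zero>}"
    unfolding F_def by (intro subsetI) (rule add_span_mono)
  moreover have "f = \<zero>" if "f \<in> add_span R {\<zero>}" for f
    using that by (induction rule: add_span.induct) auto
  ultimately show ?thesis using F_zero by blast
qed

end

section \<open>The Davenport constant is at most the Loewy length\<close>

lemma (in monoid) list_prod_Nil: "list_prod G [] = \<one>"
  and list_prod_Cons: "list_prod G (x # xs) = x \<otimes> list_prod G xs"
  by (simp_all add: list_prod_def)

lemma (in monoid) list_prod_closed: "set xs \<subseteq> carrier G \<Longrightarrow> list_prod G xs \<in> carrier G"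
  by (induction xs) (auto simp: list_prod_Nil list_prod_Cons)

lemma (in monoid) list_prod_snoc:
  "set xs \<subseteq> carrier G \<Longrightarrow> g \<in> carrier G \<Longrightarrow> list_prod G (xs @ [g]) = list_prod G xs \<otimes> g"
  by (induction xs) (auto simp: list_prod_Nil list_prod_Cons list_prod_closed m_assoc)

lemma (in monoid) list_prod_replicate_append:
  assumes "x \<in> carrier G" "set ys \<subseteq> carrier G"
  shows "list_prod G (replicate n x @ ys) = x [^] n \<otimes> list_prod G ys"
proof (induction n)
  case (Suc n)
  have "x \<otimes> x [^] n = x [^] Suc n" using assms nat_pow_Suc2[of x n] by simp
  then show ?case
    using Suc assms list_prod_closed[of ys] by (simp add: list_prod_Cons m_assoc[symmetric])
qed (use assms list_prod_closed[of ys] in simp)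

lemma set_mono_subseq: "subseq xs ys \<Longrightarrow> set xs \<subseteq> set ys"
  by (induction rule: list_emb.induct) auto

lemma ordered_products_append_left: "ordered_products G S \<subseteq> ordered_products G (S @ S')"
  by (fastforce simp: ordered_products_def intro: subseq_order.trans[OF _ subseq_rev_drop_many])

lemma (in monoid) ordered_products_snoc:
  assumes "set S \<subseteq> carrier G" "g \<in> carrier G" "h \<in> insert \<one> (ordered_products G S)"
  shows "h \<otimes> g \<in> ordered_products G (S @ [g])"
proof -
  have "\<exists>T. subseq T S \<and> h = list_prod G T"
  proof (cases "h = \<one>")
    case True
    then show ?thesis by (intro exI[of _ "[]"]) (simp add: list_prod_Nil)
  next
    case False
    then show ?thesis using assms(3) by (auto simp: ordered_products_def)
  qed
  then obtain T where T: "subseq T S" "h = list_prod G T" by blast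
  have "set T \<subseteq> carrier G" using set_mono_subseq[OF T(1)] assms(1) by blast
  then have "h \<otimes> g = list_prod G (T @ [g])"
    using assms T by (simp add: list_prod_snoc)
  moreover have "subseq (T @ [g]) (S @ [g])" using T(1) by simp
  ultimately show ?thesis by (fastforce simp: ordered_products_def)
qed

locale binary_group_algebra = G: group G for G :: "('a, 'm) monoid_scheme" +
  assumes finite_carrier: "finite (carrier G)"

sublocale binary_group_algebra \<subseteq> finite_group_algebra "residue_ring 2" G
proof -
  interpret residues 2 "residue_ring 2" by unfold_locales auto
  show "finite_group_algebra (residue_ring 2) G"
    by unfold_locales (rule finite_carrier)
qed

context binary_group_algebra
begin

lemma Z2_simps: "carrier (residue_ring 2) = {0, 1}" "\<zero>\<^bsub>residue_ring 2\<^esub> = 0" "\<one>\<^bsub>residue_ring 2\<^esub> = 1"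
  "x \<oplus>\<^bsub>residue_ring 2\<^esub> y = (x + y) mod 2"
  by (auto simp: residue_ring_def)

lemma A_value: "f \<in> carrier A \<Longrightarrow> x \<in> carrier G \<Longrightarrow> f x = 0 \<or> f x = 1"
  using A_apply Z2_simps by blast

lemma A_add_self: "f \<in> carrier A \<Longrightarrow> f \<oplus>\<^bsub>A\<^esub> f = \<zero>\<^bsub>A\<^esub>"
  by (auto simp: add_A zero_A Z2_simps fun_eq_iff)

text \<open>
By induction on the size of the support: adding a group element of the support removes it, as
nonzero coefficients are one.
\<close>

lemma of_group_span: "carrier A = add_span A (of_group ` carrier G)"
proof
  interpret A: ring A by (rule ring_A)
  show "add_span A (of_group ` carrier G) \<subseteq> carrier A"
    using A.add_span_closed of_group_closed by blast
  show "carrier A \<subseteq> add_span A (of_group ` carrier G)"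
  proof
    fix f assume "f \<in> carrier A"
    then show "f \<in> add_span A (of_group ` carrier G)"
    proof (induction "card {x \<in> carrier G. f x \<noteq> 0}" arbitrary: f rule: less_induct)
      case less
      show ?case
      proof (cases "\<exists>g\<in>carrier G. f g \<noteq> 0")
        case False
        then have "f = \<zero>\<^bsub>A\<^esub>"
          using less.prems by (intro A_eqI A.zero_closed) (simp_all add: zero_A Z2_simps)
        then show ?thesis by (simp add: add_span.zero)
      next
        case True
        then obtain g where g: "g \<in> carrier G" "f g \<noteq> 0" by blast
        let ?f = "of_group g \<oplus>\<^bsub>A\<^esub> f"
        have val: "?f x = (if x = g then 0 else f x)" if "x \<in> carrier G" for x
          using that g A_value[OF less.prems that] by (auto simp: add_A of_group_def Z2_simps)
        have "{x \<in> carrier G. ?f x \<noteq> 0} = {x \<in> carrier G. f x \<noteq> 0} - {g}"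
        proof (rule Set.set_eqI)
          fix x
          show "x \<in> {x \<in> carrier G. ?f x \<noteq> 0} \<longleftrightarrow> x \<in> {x \<in> carrier G. f x \<noteq> 0} - {g}"
            using val[of x] by (cases "x \<in> carrier G") simp_all
        qed
        then have "{x \<in> carrier G. ?f x \<noteq> 0} \<subset> {x \<in> carrier G. f x \<noteq> 0}"
          using g by blast
        then have "card {x \<in> carrier G. ?f x \<noteq> 0} < card {x \<in> carrier G. f x \<noteq> 0}"
          using finite_carrier by (intro psubset_card_mono) auto
        then have "?f \<in> add_span A (of_group ` carrier G)"
          by (rule less.hyps[OF _ add_A_closed[OF of_group_closed less.prems]])
        with g(1) have "of_group g \<oplus>\<^bsub>A\<^esub> ?f \<in> add_span A (of_group ` carrier G)"
          by (rule add_span.add[OF imageI])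
        moreover have "of_group g \<oplus>\<^bsub>A\<^esub> ?f = f"
          using less.prems of_group_closed[of g] A_add_self[OF of_group_closed[of g]]
          by (simp add: A.a_assoc[symmetric])
        ultimately show ?thesis by simp
      qed
    qed
  qed
qed

end

sublocale binary_group_algebra \<subseteq> char2_group_ring A G of_group
proof -
  interpret A: ring A by (rule ring_A)
  have "\<one>\<^bsub>A\<^esub> \<one>\<^bsub>G\<^esub> \<noteq> \<zero>\<^bsub>A\<^esub> \<one>\<^bsub>G\<^esub>"
    by (simp add: one_A zero_A of_group_def Z2_simps)
  then have "\<one>\<^bsub>A\<^esub> \<noteq> \<zero>\<^bsub>A\<^esub>" by metis
  then show "char2_group_ring A G of_group"
    using A_add_self of_group_mult of_group_closed of_group_span
    by unfold_locales (auto simp: one_A)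
qed

context binary_group_algebra
begin

text \<open>
The product of the elements \<open>1 + g\<close>. The recursion puts the head of the list last, so that
\<^const>\<open>ideal_power\<close>, which appends factors on the right, follows the same recursion; the products
of \<open>S\<close> in the group are therefore those of the reversed list.
\<close>

primrec shifted_prod :: "'a list \<Rightarrow> 'a \<Rightarrow> int" where
  "shifted_prod [] = \<one>\<^bsub>A\<^esub>"
| "shifted_prod (g # S) = shifted_prod S \<otimes>\<^bsub>A\<^esub> (of_group g \<oplus>\<^bsub>A\<^esub> \<one>\<^bsub>A\<^esub>)"

lemma shifted_prod_in_ideal_power:
  "set S \<subseteq> carrier G \<Longrightarrow> shifted_prod S \<in> ideal_power A augmentation (length S)"
proof (induction S)
  case (Cons g S)
  then have "shifted_prod S \<in> ideal_power A augmentation (length S)" "g \<in> carrier G" by simp_all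
  from ideal_prod.prod[OF this(1) augmentation_gen[OF this(2)]] show ?case by simp
qed simp

lemma shifted_prod_closed: "set S \<subseteq> carrier G \<Longrightarrow> shifted_prod S \<in> carrier A"
proof (induction S)
  case (Cons g S)
  then have "shifted_prod S \<in> carrier A" by simp
  then show ?case using of_group_closed[of g] by simp
qed simp

lemma shifted_prod_value:
  assumes "set S \<subseteq> carrier G" "g \<in> carrier G" "x \<in> carrier G"
  shows "shifted_prod (g # S) x = (shifted_prod S (x \<otimes>\<^bsub>G\<^esub> inv\<^bsub>G\<^esub> g) + shifted_prod S x) mod 2"
proof -
  have "shifted_prod (g # S) = shifted_prod S \<otimes>\<^bsub>A\<^esub> of_group g \<oplus>\<^bsub>A\<^esub> shifted_prod S"
    using assms shifted_prod_closed[of S] of_group_closed[of g] by (simp add: r_distr)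
  then show ?thesis
    using assms shifted_prod_closed[of S] by (simp add: add_A mult_of_group Z2_simps)
qed

text \<open>
Expanding the product gives a sum of products of subsequences; the empty one accounts for the
identity.
\<close>

lemma shifted_prod_support:
  assumes "set S \<subseteq> carrier G" "x \<in> carrier G" "shifted_prod S x \<noteq> 0"
  shows "x \<in> insert \<one>\<^bsub>G\<^esub> (ordered_products G (rev S))"
  using assms
proof (induction S arbitrary: x)
  case Nil
  then show ?case by (auto simp: one_A of_group_def Z2_simps split: if_splits)
next
  case (Cons g S)
  then have g: "g \<in> carrier G" and S: "set S \<subseteq> carrier G" by auto
  from Cons.prems g S consider "shifted_prod S (x \<otimes>\<^bsub>G\<^esub> inv\<^bsub>G\<^esub> g) \<noteq> 0" | "shifted_prod S x \<noteq> 0"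
    using shifted_prod_value[OF S g, of x] by fastforce
  then show ?case
  proof cases
    case 1
    then have "x \<otimes>\<^bsub>G\<^esub> inv\<^bsub>G\<^esub> g \<in> insert \<one>\<^bsub>G\<^esub> (ordered_products G (rev S))"
      using Cons g S by simp
    from G.ordered_products_snoc[OF _ g this] show ?thesis
      using S g Cons.prems by (simp add: G.m_assoc)
  next
    case 2
    then show ?thesis
      using Cons.IH[OF S] Cons.prems ordered_products_append_left[of G "rev S" "[g]"] by auto
  qed
qed

text \<open>
The empty subsequence contributes one to the coefficient of the identity. A further
contribution when \<open>g\<close> is appended would come from the coefficient of \<open>g\<^sup>-\<^sup>1\<close>, but if \<open>g\<^sup>-\<^sup>1\<close> were
the product of a subsequence, appending \<open>g\<close> would yield product one.
\<close>

lemma shifted_prod_at_one: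
  assumes "set S \<subseteq> carrier G" "\<one>\<^bsub>G\<^esub> \<notin> ordered_products G (rev S)"
  shows "shifted_prod S \<one>\<^bsub>G\<^esub> = 1"
  using assms
proof (induction S)
  case Nil
  then show ?case by (simp add: one_A of_group_def Z2_simps)
next
  case (Cons g S)
  then have g: "g \<in> carrier G" and S: "set S \<subseteq> carrier G" by auto
  have "inv\<^bsub>G\<^esub> g \<notin> insert \<one>\<^bsub>G\<^esub> (ordered_products G (rev S))"
    using G.ordered_products_snoc[of "rev S" g "inv\<^bsub>G\<^esub> g"] g S Cons.prems by auto
  then have "shifted_prod S (inv\<^bsub>G\<^esub> g) = 0"
    using shifted_prod_support[OF S, of "inv\<^bsub>G\<^esub> g"] g by blast
  moreover have "shifted_prod S \<one>\<^bsub>G\<^esub> = 1"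
    using Cons ordered_products_append_left[of G "rev S" "[g]"] by auto
  ultimately show ?case
    using shifted_prod_value[OF S g, of "\<one>\<^bsub>G\<^esub>"] g by simp
qed

lemma product_one_if_vanishing_power:
  assumes "ideal_power A augmentation n = {\<zero>\<^bsub>A\<^esub>}" "set S \<subseteq> carrier G" "n \<le> length S"
  shows "\<one>\<^bsub>G\<^esub> \<in> ordered_products G S"
proof (rule ccontr)
  assume "\<one>\<^bsub>G\<^esub> \<notin> ordered_products G S"
  moreover let ?T = "take n S"
  have "ordered_products G ?T \<subseteq> ordered_products G S"
    using ordered_products_append_left[of G ?T "drop n S"] by simp
  ultimately have "shifted_prod (rev ?T) \<one>\<^bsub>G\<^esub> = 1"
    using assms by (intro shifted_prod_at_one) (auto dest: in_set_takeD)
  moreover have "set (rev ?T) \<subseteq> carrier G" using assms by (auto dest: in_set_takeD)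
  then have "shifted_prod (rev ?T) \<in> ideal_power A augmentation (length (rev ?T))"
    by (rule shifted_prod_in_ideal_power)
  then have "shifted_prod (rev ?T) = \<zero>\<^bsub>A\<^esub>" using assms(1,3) by (simp add: min_absorb2)
  ultimately show False by (simp add: zero_A Z2_simps)
qed

text \<open>
The chain \<open>N \<le> D \<le> L \<le> N\<close> for the two constants \<open>D\<close> and \<open>L\<close>: the outer inequalities come
from \<open>S\<close> and from the vanishing power of the augmentation ideal, respectively.
\<close>

theorem ordered_davenport_eq_loewy_length:
  assumes N: "1 \<le> N" "ideal_power A augmentation N = {\<zero>\<^bsub>A\<^esub>}"
    and S: "set S \<subseteq> carrier G" "Suc (length S) = N" "\<one>\<^bsub>G\<^esub> \<notin> ordered_products G S"
  shows "ordered_davenport G = loewy_length 2 G"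
proof -
  define vanish where "vanish n \<longleftrightarrow> n \<ge> 1 \<and> ideal_power A augmentation n = {\<zero>\<^bsub>A\<^esub>}" for n
  define forced where
    "forced k \<longleftrightarrow> (\<forall>S. set S \<subseteq> carrier G \<and> length S \<ge> k \<longrightarrow> \<one>\<^bsub>G\<^esub> \<in> ordered_products G S)" for k
  have L: "loewy_length 2 G = (LEAST n. vanish n)"
    using jacobson_radical_eq_augmentation[OF N(2)] by (simp add: loewy_length_def vanish_def Let_def)
  have D: "ordered_davenport G = (LEAST k. forced k)"
    by (simp add: ordered_davenport_def forced_def)
  have vN: "vanish N" using N by (simp add: vanish_def)
  have "forced (LEAST n. vanish n)"
    using product_one_if_vanishing_power LeastI[of vanish, OF vN] by (auto simp: forced_def vanish_def)
  then have "(LEAST k. forced k) \<le> (LEAST n. vanish n)" by (rule Least_le)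
  moreover have "(LEAST n. vanish n) \<le> N" using vN by (rule Least_le)
  moreover have "N \<le> (LEAST k. forced k)"
  proof (rule ccontr)
    assume "\<not> ?thesis"
    then have "(LEAST k. forced k) \<le> length S" using S(2) by simp
    moreover have "forced (LEAST k. forced k)"
      using \<open>forced (LEAST n. vanish n)\<close> by (rule LeastI)
    ultimately show False using S(1,3) unfolding forced_def by blast
  qed
  ultimately show ?thesis using L D by linarith
qed

lemma of_group_pow: "g \<in> carrier G \<Longrightarrow> of_group (g [^]\<^bsub>G\<^esub> (n::nat)) = of_group g [^]\<^bsub>A\<^esub> n"
  by (induction n) (auto simp: one_A of_group_mult[symmetric])

end

lemma subseq_replicate:
  assumes "subseq xs (replicate n x)"
  obtains k where "k \<le> n" "xs = replicate k x"
proof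
  show "length xs \<le> n" using list_emb_length[OF assms] by simp
  have "set xs \<subseteq> {x}" using set_mono_subseq[OF assms] by auto
  then show "xs = replicate (length xs) x" by (induction xs) auto
qed

section \<open>The common shape of the four families\<close>

text \<open>
The assumptions cover the split and the non-split families. The subgroup \<open>H\<close> stands for \<open>\<langle>c\<rangle> \<times> \<langle>a\<rangle>\<close>, and
\<open>b_notin\<close> says that \<open>b\<close> has order at least \<open>2\<^sup>\<beta>\<close> modulo \<open>H\<close>. For \<open>\<kappa> = 0\<close> one has \<open>c = 1\<close>, which is the
metacyclic case.
\<close>

locale metabelian_extension = group G for G (structure) +
  fixes a b c :: 'a and H :: "'a set" and \<alpha> \<beta> \<kappa> s t :: nat
  assumes finite_carrier: "finite (carrier G)"
    and abc: "a \<in> carrier G" "b \<in> carrier G" "c \<in> carrier G"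
    and ca: "c \<otimes> a = a \<otimes> c"
    and ab: "a \<otimes> b = b \<otimes> (a \<otimes> (a [^] (2 * s) \<otimes> c))"
    and cb: "c \<otimes> b = b \<otimes> (c \<otimes> a [^] (4 * t))"
    and ord_a: "ord a = 2 ^ \<alpha>"
    and ord_c: "ord c = 2 ^ \<kappa>"
    and \<kappa>: "\<kappa> \<le> 1"
    and pow_b: "b [^] (2 ^ \<beta> :: nat) \<in> {\<one>, a [^] (2 ^ \<beta> :: nat)}"
    and cover: "g \<in> carrier G \<Longrightarrow> \<exists>(k::nat) (i::nat) (j::nat). g = c [^] k \<otimes> a [^] i \<otimes> b [^] j"
    and H: "subgroup H G" "a \<in> H" "c \<in> H"
    and b_notin: "0 < j \<Longrightarrow> j < 2 ^ \<beta> \<Longrightarrow> b [^] (j::nat) \<notin> H"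
    and c_indep: "\<kappa> = 1 \<Longrightarrow> a [^] (n::nat) \<otimes> c \<noteq> \<one>"
begin

sublocale BA: binary_group_algebra G
  by unfold_locales (rule finite_carrier)

text \<open>
One more than \<open>(2\<^sup>\<alpha> - 1) + (2\<^sup>\<beta> - 1) + 2 (2\<^sup>\<kappa> - 1)\<close>, the largest weight of a monomial with
\<open>i < 2\<^sup>\<alpha>\<close>, \<open>j < 2\<^sup>\<beta>\<close> and \<open>k < 2\<^sup>\<kappa>\<close>.
\<close>

definition "N = 2 ^ \<alpha> + 2 ^ \<beta> + 2 * 2 ^ \<kappa> - (3::nat)"

lemma N_eq: "N + 3 = 2 ^ \<alpha> + 2 ^ \<beta> + 2 * 2 ^ \<kappa>"
proof -
  have "1 \<le> (2::nat) ^ \<alpha>" "1 \<le> (2::nat) ^ \<beta>" "1 \<le> (2::nat) ^ \<kappa>" by auto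
  then show ?thesis unfolding N_def by linarith
qed

lemma augmentation_power_vanishes: "ideal_power BA.A BA.augmentation N = {\<zero>\<^bsub>BA.A\<^esub>}"
proof -
  have pow_c: "c [^] (2 ^ \<kappa> :: nat) = \<one>" and pow_a: "a [^] (2 ^ \<alpha> :: nat) = \<one>"
    using abc ord_a ord_c by (metis pow_ord_eq_1)+
  interpret M: monomial_filtration BA.A "BA.of_group a" "BA.of_group b" "BA.of_group c" \<alpha> \<beta> \<kappa> s t
  proof unfold_locales
    show "BA.of_group b [^]\<^bsub>BA.A\<^esub> (2 ^ \<beta> :: nat) \<in> {\<one>\<^bsub>BA.A\<^esub>, BA.of_group a [^]\<^bsub>BA.A\<^esub> (2 ^ \<beta> :: nat)}"
      using pow_b abc by (auto simp: BA.of_group_pow[symmetric] BA.one_A)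
  qed (use abc ca ab cb pow_a pow_c in
      \<open>simp_all add: BA.of_group_closed BA.of_group_pow[symmetric] BA.of_group_mult BA.one_A\<close>)
  have raising: "BA.of_group g \<in> M.raising" if g: "g \<in> carrier G" for g
  proof -
    from cover[OF g] obtain k i j :: nat where "g = c [^] k \<otimes> a [^] i \<otimes> b [^] j" by (elim exE)
    then have "BA.of_group g = BA.of_group c [^]\<^bsub>BA.A\<^esub> k \<otimes>\<^bsub>BA.A\<^esub> BA.of_group a [^]\<^bsub>BA.A\<^esub> i
        \<otimes>\<^bsub>BA.A\<^esub> BA.of_group b [^]\<^bsub>BA.A\<^esub> j"
      using abc by (simp add: BA.of_group_mult[symmetric] BA.of_group_pow)
    then show ?thesis
      using M.raising_abc M.raising_mult M.raising_pow by simp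
  qed
  have "ideal_power BA.A BA.augmentation N \<subseteq> M.F N"
  proof (rule BA.ideal_power_subset_filtration)
    show "f \<otimes>\<^bsub>BA.A\<^esub> (BA.of_group g \<oplus>\<^bsub>BA.A\<^esub> \<one>\<^bsub>BA.A\<^esub>) \<in> M.F (Suc d)"
      if "f \<in> M.F d" "g \<in> carrier G" for d f g
      using raising[OF that(2)] that(1) by (auto simp: M.raising_def)
  qed (auto intro: M.F_zero_level M.F_zero M.F_add M.F_closed M.F_antimono)
  also have "M.F N = {\<zero>\<^bsub>BA.A\<^esub>}"
    using N_eq by (intro M.F_top) simp
  finally show ?thesis using BA.zero_in_ideal_power[of N] by blast
qed

lemma b_power_in_H:
  assumes "g \<in> H" "h \<in> H" "g \<otimes> (b [^] (j::nat) \<otimes> h) = \<one>"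
  shows "b [^] j \<in> H"
proof -
  interpret H: subgroup H G by (rule H)
  have "b [^] j = inv g \<otimes> inv h"
    using assms abc H.subset
    by (metis H.mem_carrier inv_closed inv_solve_left inv_solve_right nat_pow_closed r_one m_closed one_closed)
  then show ?thesis using assms by simp
qed

text \<open>
For \<open>\<kappa> = 1\<close> the copies of \<open>a\<close> and \<open>b\<close> alone are two terms too few. The extra terms are chosen such
that moving \<open>a c\<close> past a single \<open>b\<close> turns it into a power of \<open>a\<close>, because \<open>c\<^sup>2 = 1\<close>: the factor \<open>c\<close> of \<open>a c\<close> cancels
against the one from \<open>[a, b]\<close>, and the factor \<open>c\<close> of \<open>b c\<close> survives.
\<close>

definition free_seq :: "'a list" where
  "free_seq = replicate (2 ^ \<alpha> - 1) a @ replicate (2 ^ \<beta> - 1) b @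
     (if \<kappa> = 1 then [a \<otimes> c, b \<otimes> c] else [])"

lemma free_seq_length: "Suc (length free_seq) = N"
proof -
  obtain p q where "(2::nat) ^ \<alpha> = Suc p" "(2::nat) ^ \<beta> = Suc q"
    by (metis gr0_conv_Suc pos2 zero_less_power)
  moreover have "\<kappa> = 0 \<or> \<kappa> = 1" using \<kappa> by auto
  ultimately show ?thesis by (auto simp: N_def free_seq_def)
qed

lemma free_seq_closed: "set free_seq \<subseteq> carrier G"
  using abc by (auto simp: free_seq_def)

lemma ac_bc:
  assumes "\<kappa> = 1"
  obtains n :: nat where "(a \<otimes> c) \<otimes> (b \<otimes> c) = b \<otimes> (a [^] n \<otimes> c)"
proof
  have cc: "c \<otimes> c = \<one>"
    using pow_ord_eq_1[OF abc(3)] assms abc by (simp add: ord_c numeral_2_eq_2)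
  have ca_pow: "c \<otimes> a [^] n = a [^] n \<otimes> c" for n :: nat
    using abc ca by (induction n) (simp_all add: m_assoc[symmetric], simp add: m_assoc)
  have "(a \<otimes> c) \<otimes> (b \<otimes> c) = a \<otimes> (c \<otimes> b) \<otimes> c"
    using abc by (simp add: m_assoc)
  also have "\<dots> = (a \<otimes> b) \<otimes> (c \<otimes> a [^] (4 * t)) \<otimes> c"
    using abc by (simp add: cb m_assoc)
  also have "\<dots> = b \<otimes> (a \<otimes> a [^] (2 * s) \<otimes> (c \<otimes> c) \<otimes> a [^] (4 * t) \<otimes> c)"
    using abc by (simp add: ab m_assoc)
  also have "\<dots> = b \<otimes> (a [^] (1 + 2 * s + 4 * t) \<otimes> c)"
    using abc by (simp add: cc nat_pow_mult[symmetric] del: nat_pow_Suc add_Suc)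
  finally show "(a \<otimes> c) \<otimes> (b \<otimes> c) = b \<otimes> (a [^] (1 + 2 * s + 4 * t) \<otimes> c)" .
qed

text \<open>
If the product is one, then \<open>b\<^sup>j\<close> lies in \<open>H\<close> and \<open>j\<close> is \<open>2\<^sup>\<beta>\<close>, so that \<open>b\<^sup>j\<close> is a power of \<open>a\<close>. This would
make \<open>c\<close> a power of \<open>a\<close> as well.
\<close>

lemma a_b_c_not_one:
  assumes "\<kappa> = 1" "0 < j" "j \<le> 2 ^ \<beta>"
  shows "a [^] (i::nat) \<otimes> (b [^] (j::nat) \<otimes> (a [^] (n::nat) \<otimes> c)) \<noteq> \<one>"
proof
  interpret H: subgroup H G by (rule H)
  have pows: "a [^] m \<in> H" for m :: nat using H by (induction m) auto
  assume eq: "a [^] i \<otimes> (b [^] j \<otimes> (a [^] n \<otimes> c)) = \<one>"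
  then have "b [^] j \<in> H" using pows H by (intro b_power_in_H) auto
  then have j: "j = 2 ^ \<beta>" using b_notin assms(2,3) by (metis order_le_less)
  obtain r :: nat where "b [^] j = a [^] r"
  proof (cases "b [^] j = \<one>")
    case True
    then show thesis using that[of 0] by simp
  next
    case False
    then show thesis using that[of j] pow_b j by auto
  qed
  then have "a [^] (i + (r + n)) \<otimes> c = \<one>"
    using eq abc by (simp add: nat_pow_mult[symmetric] m_assoc)
  then show False using c_indep assms by blast
qed

text \<open>
A subsequence has the product \<open>a\<^sup>i b\<^sup>j\<close> times a product of some of \<open>a c\<close> and \<open>b c\<close>. Without \<open>b c\<close>, modulo
\<open>H\<close> only \<open>j = 0\<close> is possible, and then \<open>a\<^sup>i\<close> or \<open>a\<^sup>i\<^sup>+\<^sup>1 c\<close> would have to be one. With \<open>b c\<close>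
the product has the form \<open>a\<^sup>i b\<^sup>j\<^sup>+\<^sup>1 a\<^sup>n c\<close>, which is never one.
\<close>

lemma free_seq_free: "\<one> \<notin> ordered_products G free_seq"
proof
  interpret H: subgroup H G by (rule H)
  have pows: "a [^] m \<in> H" for m :: nat using H by (induction m) auto
  have pos: "(2::nat) ^ \<beta> > 0" "(2::nat) ^ \<alpha> > 0" by auto
  assume "\<one> \<in> ordered_products G free_seq"
  then obtain T where T: "T \<noteq> []" "subseq T free_seq" "list_prod G T = \<one>"
    by (auto simp: ordered_products_def)
  then obtain T1 T2 T3 where T123: "T = T1 @ T2 @ T3" "subseq T1 (replicate (2 ^ \<alpha> - 1) a)"
    "subseq T2 (replicate (2 ^ \<beta> - 1) b)" "subseq T3 (if \<kappa> = 1 then [a \<otimes> c, b \<otimes> c] else [])"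
    unfolding free_seq_def by (elim subseq_appendE) blast
  obtain i where i: "i \<le> 2 ^ \<alpha> - 1" "T1 = replicate i a" using subseq_replicate T123 by metis
  obtain j where j: "j \<le> 2 ^ \<beta> - 1" "T2 = replicate j b" using subseq_replicate T123 by metis
  have T3: "T3 = [] \<or> \<kappa> = 1 \<and> (T3 = [a \<otimes> c] \<or> T3 = [b \<otimes> c] \<or> T3 = [a \<otimes> c, b \<otimes> c])"
  proof -
    have "T3 \<in> set (subseqs (if \<kappa> = 1 then [a \<otimes> c, b \<otimes> c] else []))"
      using T123(4) by simp
    then show ?thesis by (cases "\<kappa> = 1") (auto simp: Let_def simp del: in_set_subseqs)
  qed
  have T3_closed: "set T3 \<subseteq> carrier G" using T3 abc by auto
  then have "set (replicate j b @ T3) \<subseteq> carrier G" using abc by auto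
  with T3_closed have prod: "a [^] i \<otimes> (b [^] j \<otimes> list_prod G T3) = \<one>"
    using T(3) abc by (simp only: T123(1) i(2) j(2) list_prod_replicate_append)
  have j0: "j = 0" if "list_prod G T3 \<in> H"
    using b_power_in_H[OF pows that prod] b_notin[of j] j(1) pos by force
  have c_end: False if "\<kappa> = 1" and eq: "list_prod G T3 = b \<otimes> (a [^] (n::nat) \<otimes> c)" for n
  proof -
    have "a [^] i \<otimes> (b [^] Suc j \<otimes> (a [^] n \<otimes> c)) = \<one>"
      using prod abc by (simp add: eq m_assoc)
    moreover have "Suc j \<le> 2 ^ \<beta>" using j(1) pos by linarith
    ultimately show False using a_b_c_not_one[OF \<open>\<kappa> = 1\<close>, of "Suc j"] by blast
  qed
  from T3 consider "T3 = []" | "\<kappa> = 1" "T3 = [a \<otimes> c]" | "\<kappa> = 1" "T3 = [b \<otimes> c]"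
    | "\<kappa> = 1" "T3 = [a \<otimes> c, b \<otimes> c]" by blast
  then show False
  proof cases
    case 1
    then have "j = 0" using j0 by (simp add: list_prod_Nil)
    then have "a [^] i = \<one>" using prod abc 1 by (simp add: list_prod_Nil)
    then have "2 ^ \<alpha> dvd i" using pow_eq_id[OF abc(1), of i] ord_a by simp
    then have "i = 0" using i(1) pos by (metis Suc_pred' dvd_imp_le less_Suc_eq_le linorder_not_le neq0_conv)
    with \<open>j = 0\<close> 1 T T123 i j show False by simp
  next
    case 2
    then have "j = 0" using j0 H by (simp add: list_prod_Nil list_prod_Cons)
    then have "a [^] Suc i \<otimes> c = \<one>"
      using prod abc 2 by (simp add: list_prod_Nil list_prod_Cons m_assoc)
    then show False using c_indep 2 by blast
  next
    case 3
    then show False using c_end[of 0] abc by (simp add: list_prod_Nil list_prod_Cons)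
  next
    case 4
    then obtain n :: nat where "(a \<otimes> c) \<otimes> (b \<otimes> c) = b \<otimes> (a [^] n \<otimes> c)" using ac_bc by blast
    then show False using c_end[of n] 4 abc by (simp add: list_prod_Nil list_prod_Cons)
  qed
qed

theorem ordered_davenport_eq_loewy_length: "ordered_davenport G = loewy_length 2 G"
  using BA.ordered_davenport_eq_loewy_length[OF _ augmentation_power_vanishes
      free_seq_closed free_seq_length free_seq_free] free_seq_length by simp

end

section \<open>The four families\<close>

context group
begin

lemma commutator_relation:
  assumes "x \<in> carrier G" "y \<in> carrier G" "group_commutator G x y = w"
  shows "x \<otimes> y = y \<otimes> (x \<otimes> w)"
proof -
  have cancel: "u \<otimes> (inv u \<otimes> v) = v" if "u \<in> carrier G" "v \<in> carrier G" for u v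
    using that by (simp add: m_assoc[symmetric])
  show ?thesis
    using assms(1,2) by (simp add: assms(3)[symmetric] group_commutator_def m_assoc cancel)
qed

lemma finite_cyclic_sub: "x \<in> carrier G \<Longrightarrow> ord x \<noteq> 0 \<Longrightarrow> finite (cyclic_sub G x)"
  using generate_pow_card[of x] card_gt_0_iff by fastforce

lemma cyclic_product_elements:
  assumes "a \<in> carrier G" "c \<in> carrier G" "ord a \<noteq> 0" "ord c \<noteq> 0"
    and "x \<in> cyclic_sub G c <#> cyclic_sub G a"
  obtains k i :: nat where "x = c [^] k \<otimes> a [^] i"
  using assms by (auto simp: set_mult_def generate_pow_nat)

lemma cyclic_product_cover:
  assumes abc: "a \<in> carrier G" "b \<in> carrier G" "c \<in> carrier G"
    and ord: "ord a \<noteq> 0" "ord b \<noteq> 0" "ord c \<noteq> 0"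
    and prod: "(cyclic_sub G c <#> cyclic_sub G a) <#> cyclic_sub G b = carrier G"
  shows "finite (carrier G)"
    and "g \<in> carrier G \<Longrightarrow> \<exists>(k::nat) (i::nat) (j::nat). g = c [^] k \<otimes> a [^] i \<otimes> b [^] j"
proof -
  have "finite (cyclic_sub G c <#> cyclic_sub G a)"
    using abc ord unfolding set_mult_def by (intro finite_UN_I) (auto simp: finite_cyclic_sub)
  then have "finite ((cyclic_sub G c <#> cyclic_sub G a) <#> cyclic_sub G b)"
    using abc ord unfolding set_mult_def[of G "cyclic_sub G c <#> cyclic_sub G a"]
    by (intro finite_UN_I) (auto simp: finite_cyclic_sub)
  then show "finite (carrier G)" by (simp only: prod)
  assume "g \<in> carrier G"
  then have "g \<in> (cyclic_sub G c <#> cyclic_sub G a) <#> cyclic_sub G b" by (simp only: prod)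
  then obtain x y where xy: "x \<in> cyclic_sub G c <#> cyclic_sub G a" "y \<in> cyclic_sub G b" "g = x \<otimes> y"
    unfolding set_mult_def[of G "cyclic_sub G c <#> cyclic_sub G a"] by blast
  obtain k i :: nat where "x = c [^] k \<otimes> a [^] i"
    using cyclic_product_elements[OF abc(1,3) ord(1,3) xy(1)] by blast
  moreover obtain j :: nat where "y = b [^] j"
    using xy(2) abc ord by (auto simp: generate_pow_nat)
  ultimately show "\<exists>(k::nat) (i::nat) (j::nat). g = c [^] k \<otimes> a [^] i \<otimes> b [^] j"
    using xy(3) by blast
qed

lemma cyclic_product_mem:
  assumes "a \<in> carrier G" "c \<in> carrier G"
  shows "a \<in> cyclic_sub G c <#> cyclic_sub G a" "c \<in> cyclic_sub G c <#> cyclic_sub G a"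
proof -
  have "\<one> \<otimes> a \<in> cyclic_sub G c <#> cyclic_sub G a" "c \<otimes> \<one> \<in> cyclic_sub G c <#> cyclic_sub G a"
    unfolding set_mult_def using generate.one[of G] generate.incl[of _ _ G] by blast+
  then show "a \<in> cyclic_sub G c <#> cyclic_sub G a" "c \<in> cyclic_sub G c <#> cyclic_sub G a"
    using assms by simp_all
qed

lemma direct_independent:
  assumes abc: "a \<in> carrier G" "c \<in> carrier G" "c \<noteq> \<one>"
    and direct: "internal_direct G (cyclic_sub G c) (cyclic_sub G a)"
  shows "a [^] (n::nat) \<otimes> c \<noteq> \<one>"
proof
  assume "a [^] n \<otimes> c = \<one>"
  then have "c = inv (a [^] n)"
    using abc by (metis inv_equality inv_inv nat_pow_closed)
  also have "\<dots> = a [^] (- int n)" using abc by (simp add: int_pow_neg_int)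
  also have "\<dots> \<in> cyclic_sub G a" using abc by (auto simp: generate_pow)
  finally have "c \<in> cyclic_sub G c \<inter> cyclic_sub G a" by (auto intro: generate.incl)
  then have "c \<in> {\<one>}" using direct unfolding internal_direct_def by (elim conjE) simp
  then show False using abc by simp
qed

lemma direct_commute:
  assumes "internal_direct G (cyclic_sub G c) (cyclic_sub G a)"
  shows "c \<otimes> a = a \<otimes> c"
  using assms by (auto simp: internal_direct_def intro: generate.incl)

text \<open>
The relations of the third family contain a negative exponent, whereas weights are computed for
natural exponents; in a finite cyclic group this is no restriction.
\<close>

lemma int_pow_four_nat:
  assumes a: "a \<in> carrier G" and ord: "ord a \<noteq> 0"
  obtains t :: nat where "a [^] (4 * k :: int) = a [^] (4 * t)"
proof -
  have "a [^] (4 * k) = (a [^] (4::int)) [^] k" using a by (simp add: int_pow_pow)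
  also have "\<dots> \<in> generate G {a [^] (4::nat)}"
    using a int_pow_int[of G a 4] by (auto simp: generate_pow)
  finally have "a [^] (4 * k) \<in> generate G {a [^] (4::nat)}" .
  moreover have "ord (a [^] (4::nat)) \<noteq> 0"
  proof
    assume "ord (a [^] (4::nat)) = 0"
    moreover have "(a [^] (4::nat)) [^] ord a = \<one>"
      using a pow_ord_eq_1[OF a] by (metis mult.commute nat_pow_one nat_pow_pow)
    ultimately show False using pow_eq_id[of "a [^] (4::nat)" "ord a"] a ord by simp
  qed
  ultimately show thesis
    using that a by (auto simp: generate_pow_nat nat_pow_pow)
qed

text \<open>
In a semidirect product the order of \<open>b\<close> modulo \<open>H\<close> is the order of \<open>b\<close>, so the common shape only asks
for the commutator relations.
\<close>

lemma semidirect_family: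
  assumes abc: "a \<in> carrier G" "b \<in> carrier G" "c \<in> carrier G"
    and semi: "internal_semidirect G (cyclic_sub G c <#> cyclic_sub G a) (cyclic_sub G b)"
    and ca: "c \<otimes> a = a \<otimes> c"
    and ab: "a \<otimes> b = b \<otimes> (a \<otimes> (a [^] (2 * s :: nat) \<otimes> c))"
    and cb: "c \<otimes> b = b \<otimes> (c \<otimes> a [^] (4 * t :: nat))"
    and ord: "ord a = 2 ^ \<alpha>" "ord b = 2 ^ \<beta>" "ord c = 2 ^ \<kappa>"
    and \<kappa>: "\<kappa> \<le> 1"
    and c_indep: "\<And>n::nat. \<kappa> = 1 \<Longrightarrow> a [^] n \<otimes> c \<noteq> \<one>"
  shows "ordered_davenport G = loewy_length 2 G"
proof -
  let ?H = "cyclic_sub G c <#> cyclic_sub G a"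
  have ord0: "ord a \<noteq> 0" "ord b \<noteq> 0" "ord c \<noteq> 0" using ord by simp_all
  have prod: "?H <#> cyclic_sub G b = carrier G" and trivial: "?H \<inter> cyclic_sub G b = {\<one>}"
    and sub: "subgroup ?H G"
    using semi by (auto simp: internal_semidirect_def normal_imp_subgroup)
  interpret H: subgroup ?H G by (rule sub)
  interpret metabelian_extension G a b c ?H \<alpha> \<beta> \<kappa> s t
  proof unfold_locales
    show "b [^] (2 ^ \<beta> :: nat) \<in> {\<one>, a [^] (2 ^ \<beta> :: nat)}"
      using pow_ord_eq_1[OF abc(2)] ord by simp
    fix j :: nat assume j: "0 < j" "j < 2 ^ \<beta>"
    show "b [^] j \<notin> ?H"
    proof
      assume "b [^] j \<in> ?H"
      moreover have "b [^] j \<in> cyclic_sub G b"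
        using abc ord0 by (auto simp: generate_pow_nat)
      ultimately have "b [^] j = \<one>" using trivial by blast
      then show False using j pow_eq_id[OF abc(2), of j] ord by (auto dest: dvd_imp_le)
    qed
  qed (use abc ca ab cb ord \<kappa> sub c_indep cyclic_product_mem[OF abc(1,3)]
        cyclic_product_cover[OF abc ord0 prod] in simp_all)
  show ?thesis by (rule ordered_davenport_eq_loewy_length)
qed

end

lemma G1_case:
  assumes "is_G1 G \<alpha> \<beta> 1"
  shows "ordered_davenport G = loewy_length 2 G"
proof -
  interpret group G using assms by (simp add: is_G1_def)
  obtain a b c where abc: "a \<in> carrier G" "b \<in> carrier G" "c \<in> carrier G"
    and direct: "internal_direct G (cyclic_sub G c) (cyclic_sub G a)"
    and semi: "internal_semidirect G (cyclic_sub G c <#>\<^bsub>G\<^esub> cyclic_sub G a) (cyclic_sub G b)"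
    and comm: "group_commutator G a b = c" "group_commutator G b c = \<one>\<^bsub>G\<^esub>"
    and ord: "ord a = 2 ^ \<alpha>" "ord b = 2 ^ \<beta>" "ord c = 2 ^ 1"
    using assms unfolding is_G1_def by blast
  have c1: "c \<noteq> \<one>\<^bsub>G\<^esub>" using ord by auto
  show ?thesis
  proof (rule semidirect_family[OF abc semi direct_commute[OF direct] _ _ ord])
    show "a \<otimes>\<^bsub>G\<^esub> b = b \<otimes>\<^bsub>G\<^esub> (a \<otimes>\<^bsub>G\<^esub> (a [^]\<^bsub>G\<^esub> (2 * 0 :: nat) \<otimes>\<^bsub>G\<^esub> c))"
      using commutator_relation[OF abc(1,2) comm(1)] abc by simp
    show "c \<otimes>\<^bsub>G\<^esub> b = b \<otimes>\<^bsub>G\<^esub> (c \<otimes>\<^bsub>G\<^esub> a [^]\<^bsub>G\<^esub> (4 * 0 :: nat))"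
      using commutator_relation[OF abc(2,3) comm(2)] abc by simp
  qed (use direct_independent[OF abc(1,3) c1 direct] in simp_all)
qed

lemma G2_case:
  assumes "is_G2 G \<alpha> \<beta> \<gamma>"
  shows "ordered_davenport G = loewy_length 2 G"
proof -
  interpret group G using assms by (simp add: is_G2_def)
  obtain a b where ab: "a \<in> carrier G" "b \<in> carrier G"
    and semi: "internal_semidirect G (cyclic_sub G a) (cyclic_sub G b)"
    and comm: "group_commutator G a b = a [^]\<^bsub>G\<^esub> ((2::nat) ^ (\<alpha> - \<gamma>))"
    and ord: "ord a = 2 ^ \<alpha>" "ord b = 2 ^ \<beta>"
    using assms unfolding is_G2_def by blast
  \<comment> \<open>From \<open>\<alpha> \<ge> 2 \<gamma>\<close> and \<open>\<gamma> \<ge> 1\<close>.\<close>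
  have "\<alpha> - \<gamma> = Suc (\<alpha> - \<gamma> - 1)" using assms by (auto simp: is_G2_def)
  then have even: "(2::nat) ^ (\<alpha> - \<gamma>) = 2 * 2 ^ (\<alpha> - \<gamma> - 1)" by (metis power_Suc)
  have "cyclic_sub G a \<subseteq> carrier G" using ab generate_incl by simp
  then have "\<one>\<^bsub>G\<^esub> \<otimes>\<^bsub>G\<^esub> x = x" if "x \<in> cyclic_sub G a" for x using that by auto
  then have trivial: "cyclic_sub G \<one>\<^bsub>G\<^esub> <#>\<^bsub>G\<^esub> cyclic_sub G a = cyclic_sub G a"
    by (simp add: set_mult_def generate_one)
  show ?thesis
  proof (rule semidirect_family[OF ab one_closed])
    show "internal_semidirect G (cyclic_sub G \<one>\<^bsub>G\<^esub> <#>\<^bsub>G\<^esub> cyclic_sub G a) (cyclic_sub G b)"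
      using semi by (simp only: trivial)
    show "a \<otimes>\<^bsub>G\<^esub> b = b \<otimes>\<^bsub>G\<^esub> (a \<otimes>\<^bsub>G\<^esub> (a [^]\<^bsub>G\<^esub> (2 * 2 ^ (\<alpha> - \<gamma> - 1) :: nat) \<otimes>\<^bsub>G\<^esub> \<one>\<^bsub>G\<^esub>))"
      using commutator_relation[OF ab comm] ab by (simp add: even)
    show "\<one>\<^bsub>G\<^esub> \<otimes>\<^bsub>G\<^esub> b = b \<otimes>\<^bsub>G\<^esub> (\<one>\<^bsub>G\<^esub> \<otimes>\<^bsub>G\<^esub> a [^]\<^bsub>G\<^esub> (4 * 0 :: nat))"
      using ab by simp
    show "ord \<one>\<^bsub>G\<^esub> = 2 ^ 0" by simp
  qed (use ab ord in simp_all)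
qed

lemma G3_case:
  assumes "is_G3 G \<alpha> \<beta> \<gamma> 1"
  shows "ordered_davenport G = loewy_length 2 G"
proof -
  interpret group G using assms by (simp add: is_G3_def)
  obtain a b c where abc: "a \<in> carrier G" "b \<in> carrier G" "c \<in> carrier G"
    and direct: "internal_direct G (cyclic_sub G c) (cyclic_sub G a)"
    and semi: "internal_semidirect G (cyclic_sub G c <#>\<^bsub>G\<^esub> cyclic_sub G a) (cyclic_sub G b)"
    and comm: "group_commutator G a b = a [^]\<^bsub>G\<^esub> ((2::nat) ^ (\<alpha> - \<gamma>)) \<otimes>\<^bsub>G\<^esub> c"
      "group_commutator G c b = a [^]\<^bsub>G\<^esub> (- ((2::int) ^ (2 * (\<alpha> - \<gamma>))))
         \<otimes>\<^bsub>G\<^esub> c [^]\<^bsub>G\<^esub> (- ((2::int) ^ (\<alpha> - \<gamma>)))"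
    and ord: "ord a = 2 ^ \<alpha>" "ord b = 2 ^ \<beta>" "ord c = 2 ^ 1"
    using assms unfolding is_G3_def by blast
  have c1: "c \<noteq> \<one>\<^bsub>G\<^esub>" using ord by auto
  \<comment> \<open>As \<open>\<gamma> \<ge> 2\<close> and \<open>\<alpha> + 1 \<ge> 2 \<gamma>\<close>, the difference \<open>\<alpha> - \<gamma>\<close> is positive.\<close>
  define m where "m = \<alpha> - \<gamma> - 1"
  have m: "\<alpha> - \<gamma> = Suc m" using assms by (auto simp: is_G3_def m_def)
  have "c [^]\<^bsub>G\<^esub> (- ((2::int) ^ (\<alpha> - \<gamma>))) = (c [^]\<^bsub>G\<^esub> (2::int)) [^]\<^bsub>G\<^esub> (- (2 ^ m) :: int)"
    using abc by (simp add: int_pow_pow m)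
  also have "c [^]\<^bsub>G\<^esub> (2::int) = \<one>\<^bsub>G\<^esub>"
    using int_pow_int[of G c 2] pow_ord_eq_1[OF abc(3)] ord by simp
  finally have c2: "c [^]\<^bsub>G\<^esub> (- ((2::int) ^ (\<alpha> - \<gamma>))) = \<one>\<^bsub>G\<^esub>" by simp
  have "ord a \<noteq> 0" using ord by simp
  then obtain t :: nat where "a [^]\<^bsub>G\<^esub> (4 * (- (2 ^ (2 * m))) :: int) = a [^]\<^bsub>G\<^esub> (4 * t)"
    using int_pow_four_nat[OF abc(1)] by blast
  then have t: "a [^]\<^bsub>G\<^esub> (- ((2::int) ^ (2 * (\<alpha> - \<gamma>)))) = a [^]\<^bsub>G\<^esub> (4 * t)"
    by (simp add: m)
  show ?thesis
  proof (rule semidirect_family[OF abc semi direct_commute[OF direct] _ _ ord])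
    show "a \<otimes>\<^bsub>G\<^esub> b = b \<otimes>\<^bsub>G\<^esub> (a \<otimes>\<^bsub>G\<^esub> (a [^]\<^bsub>G\<^esub> (2 * 2 ^ m :: nat) \<otimes>\<^bsub>G\<^esub> c))"
      using commutator_relation[OF abc(1,2) comm(1)] by (simp add: m)
    show "c \<otimes>\<^bsub>G\<^esub> b = b \<otimes>\<^bsub>G\<^esub> (c \<otimes>\<^bsub>G\<^esub> a [^]\<^bsub>G\<^esub> (4 * t))"
      using commutator_relation[OF abc(3,2) comm(2)] abc by (simp add: c2 t)
  qed (use direct_independent[OF abc(1,3) c1 direct] in simp_all)
qed

lemma (in group) pow_past:
  assumes "x \<in> carrier G" "y \<in> carrier G" "b \<in> carrier G" "x \<otimes> b = b \<otimes> y"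
  shows "x [^] (n::nat) \<otimes> b = b \<otimes> y [^] n"
proof (induction n)
  case (Suc n)
  have "x [^] Suc n \<otimes> b = x [^] n \<otimes> b \<otimes> y"
    using assms by (simp add: m_assoc)
  also have "\<dots> = b \<otimes> y [^] Suc n"
    using assms by (simp add: Suc m_assoc)
  finally show ?case .
qed (use assms in simp)

text \<open>
Conjugation by \<open>b\<close> sends \<open>a\<close> to \<open>a\<^sup>3 c\<close> and \<open>c\<close> to \<open>c a\<^sup>4\<close>, and therefore \<open>a\<^sup>3\<close> to \<open>(a\<^sup>3 c)\<^sup>3 = a c\<close>.
Doing it twice takes \<open>a\<close> to \<open>a c c a\<^sup>4 = a\<^sup>5\<close>.
\<close>

lemma (in group) square_of_b_past_a:
  assumes abc: "a \<in> carrier G" "b \<in> carrier G" "c \<in> carrier G"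
    and ca: "c \<otimes> a = a \<otimes> c"
    and ab: "a \<otimes> b = b \<otimes> (a \<otimes> (a [^] (2::nat) \<otimes> c))"
    and cb: "c \<otimes> b = b \<otimes> (c \<otimes> a [^] (4::nat))"
    and pows: "a [^] (8::nat) = \<one>" "c \<otimes> c = \<one>"
  shows "a \<otimes> b [^] (2::nat) = b [^] (2::nat) \<otimes> a [^] (5::nat)"
proof -
  have pow3: "x [^] (3::nat) = x \<otimes> x \<otimes> x" if "x \<in> carrier G" for x
    using that by (simp add: numeral_3_eq_3)
  have w: "a \<otimes> (a [^] (2::nat) \<otimes> c) = a [^] (3::nat) \<otimes> c"
    using abc by (simp add: pow3 numeral_2_eq_2 m_assoc)
  have a3c: "a [^] (3::nat) \<otimes> c = c \<otimes> a [^] (3::nat)"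
    using abc ca by (simp add: pow3 m_assoc[symmetric]) (simp add: m_assoc ca)
  have a9: "a [^] (9::nat) = a"
    using nat_pow_mult[OF abc(1), of 8 1] pows abc by simp
  have "(a [^] (3::nat) \<otimes> c) [^] (3::nat) = (a [^] (3::nat)) [^] (3::nat) \<otimes> c [^] (3::nat)"
    using abc a3c by (intro pow_mult_distrib) auto
  also have "\<dots> = a \<otimes> c"
    using abc by (simp add: nat_pow_pow a9 pow3[of c] pows)
  finally have cube: "a [^] (3::nat) \<otimes> b = b \<otimes> (a \<otimes> c)"
    using pow_past[of a "a [^] (3::nat) \<otimes> c" b 3] abc ab w by simp
  have "a \<otimes> b [^] (2::nat) = (a \<otimes> b) \<otimes> b"
    using abc by (simp add: numeral_2_eq_2 m_assoc)
  also have "\<dots> = b \<otimes> (a [^] (3::nat) \<otimes> (c \<otimes> b))"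
    using abc by (simp add: ab w m_assoc)
  also have "\<dots> = b \<otimes> ((a [^] (3::nat) \<otimes> b) \<otimes> (c \<otimes> a [^] (4::nat)))"
    using abc by (simp add: cb m_assoc)
  also have "\<dots> = b \<otimes> b \<otimes> (a \<otimes> (c \<otimes> c) \<otimes> a [^] (4::nat))"
    using abc by (simp add: cube m_assoc)
  also have "\<dots> = b [^] (2::nat) \<otimes> a [^] (5::nat)"
    using abc nat_pow_mult[OF abc(1), of 1 4] by (simp add: pows numeral_2_eq_2)
  finally show ?thesis .
qed

text \<open>
The product with \<open>\<langle>b\<rangle>\<close> is not semidirect here, so the order of \<open>b\<close> modulo \<open>H = \<langle>c\<rangle> \<times> \<langle>a\<rangle>\<close> has to be
determined. Elements of \<open>H\<close> commute with \<open>a\<close>. The element \<open>b\<close> does not, because \<open>[a, b] \<noteq> 1\<close>; for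
\<open>\<gamma> = 2\<close> neither does \<open>b\<^sup>2\<close>, because it conjugates \<open>a\<close> to \<open>a\<^sup>5 \<noteq> a\<close>.
\<close>

lemma G4_case:
  assumes G4: "is_G4 G \<gamma>" and \<gamma>: "\<gamma> \<in> {1, 2}"
  shows "ordered_davenport G = loewy_length 2 G"
proof -
  interpret group G using G4 by (simp add: is_G4_def)
  obtain a b c where abc: "a \<in> carrier G" "b \<in> carrier G" "c \<in> carrier G"
    and direct: "internal_direct G (cyclic_sub G c) (cyclic_sub G a)"
    and norm: "(cyclic_sub G c <#>\<^bsub>G\<^esub> cyclic_sub G a) \<lhd> G"
    and prod: "(cyclic_sub G c <#>\<^bsub>G\<^esub> cyclic_sub G a) <#>\<^bsub>G\<^esub> cyclic_sub G b = carrier G"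
    and ord: "ord a = 2 ^ (\<gamma> + 1)" "ord b = 2 ^ (\<gamma> + 1)"
      "ord (group_commutator G a b) = 2 ^ \<gamma>" "ord c = 2 ^ (\<gamma> - 1)"
    and comm: "group_commutator G a b = a [^]\<^bsub>G\<^esub> (2::nat) \<otimes>\<^bsub>G\<^esub> c"
      "group_commutator G c b = a [^]\<^bsub>G\<^esub> (-4::int) \<otimes>\<^bsub>G\<^esub> c [^]\<^bsub>G\<^esub> (-2::int)"
    and pow: "a [^]\<^bsub>G\<^esub> ((2::nat) ^ \<gamma>) = b [^]\<^bsub>G\<^esub> ((2::nat) ^ \<gamma>)"
    using G4 unfolding is_G4_def by blast
  let ?H = "cyclic_sub G c <#>\<^bsub>G\<^esub> cyclic_sub G a"
  have sub: "subgroup ?H G" using norm by (rule normal_imp_subgroup)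
  interpret H: subgroup ?H G by (rule sub)
  note mem = cyclic_product_mem[OF abc(1,3)]
  have ord0: "ord a \<noteq> 0" "ord b \<noteq> 0" "ord c \<noteq> 0" using ord by simp_all
  have ca: "c \<otimes>\<^bsub>G\<^esub> a = a \<otimes>\<^bsub>G\<^esub> c" by (rule direct_commute[OF direct])
  have ab: "a \<otimes>\<^bsub>G\<^esub> b = b \<otimes>\<^bsub>G\<^esub> (a \<otimes>\<^bsub>G\<^esub> (a [^]\<^bsub>G\<^esub> (2::nat) \<otimes>\<^bsub>G\<^esub> c))"
    by (rule commutator_relation[OF abc(1,2) comm(1)])
  have H_commute: "x \<otimes>\<^bsub>G\<^esub> a = a \<otimes>\<^bsub>G\<^esub> x" if x: "x \<in> ?H" for x
  proof -
    obtain k i :: nat where ki: "x = c [^]\<^bsub>G\<^esub> k \<otimes>\<^bsub>G\<^esub> a [^]\<^bsub>G\<^esub> i"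
      using cyclic_product_elements[OF abc(1,3) ord0(1,3) x] by blast
    have "a \<otimes>\<^bsub>G\<^esub> c [^]\<^bsub>G\<^esub> k = c [^]\<^bsub>G\<^esub> k \<otimes>\<^bsub>G\<^esub> a"
      using pow_past[of c c a k] abc ca by simp
    then have "x \<otimes>\<^bsub>G\<^esub> a = c [^]\<^bsub>G\<^esub> k \<otimes>\<^bsub>G\<^esub> (a \<otimes>\<^bsub>G\<^esub> a [^]\<^bsub>G\<^esub> i)"
      using abc nat_pow_Suc2[OF abc(1), of i] by (simp add: ki m_assoc)
    also have "\<dots> = (c [^]\<^bsub>G\<^esub> k \<otimes>\<^bsub>G\<^esub> a) \<otimes>\<^bsub>G\<^esub> a [^]\<^bsub>G\<^esub> i" using abc by (simp add: m_assoc)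
    also have "\<dots> = a \<otimes>\<^bsub>G\<^esub> x"
      using abc \<open>a \<otimes>\<^bsub>G\<^esub> c [^]\<^bsub>G\<^esub> k = c [^]\<^bsub>G\<^esub> k \<otimes>\<^bsub>G\<^esub> a\<close>[symmetric] by (simp add: ki m_assoc)
    finally show ?thesis .
  qed
  have b_notin: "b \<notin> ?H"
  proof
    assume "b \<in> ?H"
    then have "b \<otimes>\<^bsub>G\<^esub> a = b \<otimes>\<^bsub>G\<^esub> (a \<otimes>\<^bsub>G\<^esub> group_commutator G a b)"
      using H_commute commutator_relation[OF abc(1,2) refl] by simp
    then have "group_commutator G a b = \<one>\<^bsub>G\<^esub>"
      using abc comm(1) by (metis l_cancel m_closed nat_pow_closed one_closed r_one)
    then show False using ord \<gamma> by auto
  qed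
  note cover = cyclic_product_cover[OF abc ord0 prod]
  from \<gamma> consider "\<gamma> = 1" | "\<gamma> = 2" by blast
  then show ?thesis
  proof cases
    case 1
    then have c1: "c = \<one>\<^bsub>G\<^esub>" using ord abc ord_eq_1 by simp
    interpret metabelian_extension G a b c ?H 2 1 0 1 0
    proof unfold_locales
      fix j :: nat assume "0 < j" "j < 2 ^ 1"
      then have "j = 1" by simp
      then show "b [^]\<^bsub>G\<^esub> j \<notin> ?H" using b_notin abc by simp
    qed (use abc ca ab ord 1 c1 pow mem sub cover in simp_all)
    show ?thesis by (rule ordered_davenport_eq_loewy_length)
  next
    case 2
    have c1: "c \<noteq> \<one>\<^bsub>G\<^esub>" using ord 2 by auto
    have a8: "a [^]\<^bsub>G\<^esub> (8::nat) = \<one>\<^bsub>G\<^esub>" using pow_ord_eq_1[OF abc(1)] ord 2 by simp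
    have cc: "c \<otimes>\<^bsub>G\<^esub> c = \<one>\<^bsub>G\<^esub>"
      using pow_ord_eq_1[OF abc(3)] ord 2 abc by (simp add: numeral_2_eq_2)
    have "a [^]\<^bsub>G\<^esub> (4::nat) \<otimes>\<^bsub>G\<^esub> a [^]\<^bsub>G\<^esub> (4::nat) = \<one>\<^bsub>G\<^esub>"
      using nat_pow_mult[OF abc(1), of 4 4] a8 by simp
    then have a4: "a [^]\<^bsub>G\<^esub> (-4::int) = a [^]\<^bsub>G\<^esub> (4::nat)"
      using abc int_pow_neg_int[of a 4] inv_equality[of "a [^]\<^bsub>G\<^esub> (4::nat)" "a [^]\<^bsub>G\<^esub> (4::nat)"] by simp
    have c2: "c [^]\<^bsub>G\<^esub> (-2::int) = \<one>\<^bsub>G\<^esub>"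
      using abc int_pow_neg_int[of c 2] cc by (simp add: numeral_2_eq_2)
    have cb: "c \<otimes>\<^bsub>G\<^esub> b = b \<otimes>\<^bsub>G\<^esub> (c \<otimes>\<^bsub>G\<^esub> a [^]\<^bsub>G\<^esub> (4::nat))"
      using commutator_relation[OF abc(3,2) comm(2)] abc by (simp add: a4 c2)
    have b2: "b [^]\<^bsub>G\<^esub> (2::nat) \<notin> ?H"
    proof
      assume "b [^]\<^bsub>G\<^esub> (2::nat) \<in> ?H"
      then have "b [^]\<^bsub>G\<^esub> (2::nat) \<otimes>\<^bsub>G\<^esub> a = b [^]\<^bsub>G\<^esub> (2::nat) \<otimes>\<^bsub>G\<^esub> a [^]\<^bsub>G\<^esub> (5::nat)"
        using H_commute square_of_b_past_a[OF abc ca ab cb a8 cc] by simp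
      then have "a = a [^]\<^bsub>G\<^esub> (5::nat)" using abc by simp
      also have "\<dots> = a \<otimes>\<^bsub>G\<^esub> a [^]\<^bsub>G\<^esub> (4::nat)"
        using nat_pow_mult[OF abc(1), of 1 4] abc by simp
      finally have "a [^]\<^bsub>G\<^esub> (4::nat) = \<one>\<^bsub>G\<^esub>"
        using abc by (metis l_cancel nat_pow_closed one_closed r_one)
      then show False using pow_eq_id[OF abc(1), of 4] ord 2 by simp
    qed
    have b4: "b [^]\<^bsub>G\<^esub> (4::nat) = a [^]\<^bsub>G\<^esub> (4::nat)" using pow 2 by simp
    interpret metabelian_extension G a b c ?H 3 2 1 1 1
    proof unfold_locales
      fix j :: nat assume "0 < j" "j < 2 ^ 2"
      then consider "j = 1" | "j = 2" | "j = 3" by fastforce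
      then show "b [^]\<^bsub>G\<^esub> j \<notin> ?H"
      proof cases
        \<comment> \<open>If \<open>b\<^sup>3\<close> were in \<open>H\<close>, so would be \<open>b\<^sup>6 = a\<^sup>4 b\<^sup>2\<close>.\<close>
        case 3
        show ?thesis
        proof
          assume "b [^]\<^bsub>G\<^esub> j \<in> ?H"
          moreover have "a [^]\<^bsub>G\<^esub> (4::nat) \<in> ?H"
            using mem(1) by (simp add: numeral_eq_Suc)
          ultimately have "inv\<^bsub>G\<^esub> (a [^]\<^bsub>G\<^esub> (4::nat)) \<otimes>\<^bsub>G\<^esub> (b [^]\<^bsub>G\<^esub> j \<otimes>\<^bsub>G\<^esub> b [^]\<^bsub>G\<^esub> j) \<in> ?H"
            by simp
          moreover have "b [^]\<^bsub>G\<^esub> j \<otimes>\<^bsub>G\<^esub> b [^]\<^bsub>G\<^esub> j = a [^]\<^bsub>G\<^esub> (4::nat) \<otimes>\<^bsub>G\<^esub> b [^]\<^bsub>G\<^esub> (2::nat)"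
            using abc 3 by (simp add: b4[symmetric] nat_pow_mult)
          ultimately show False using b2 abc by (simp add: m_assoc[symmetric])
        qed
      qed (use b_notin b2 abc in simp_all)
    qed (use abc ca ab cb ord 2 pow mem sub cover direct_independent[OF abc(1,3) c1 direct] in simp_all)
    show ?thesis by (rule ordered_davenport_eq_loewy_length)
  qed
qed

theorem theorem1p5:
  fixes G :: "('a, 'm) monoid_scheme"
  assumes "group G"
    and "(\<exists>\<alpha> \<beta> \<gamma>. is_G1 G \<alpha> \<beta> \<gamma> \<and> \<gamma> = 1) \<or>
         (\<exists>\<alpha> \<beta> \<gamma>. is_G2 G \<alpha> \<beta> \<gamma>) \<or>
         (\<exists>\<alpha> \<beta> \<gamma> \<sigma>. is_G3 G \<alpha> \<beta> \<gamma> \<sigma> \<and> \<sigma> = 1) \<or>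
         (\<exists>\<gamma>. is_G4 G \<gamma> \<and> \<gamma> \<in> {1, 2})"
  shows "ordered_davenport G = loewy_length 2 G"
  using assms(2) G1_case G2_case G3_case G4_case by blast

end
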